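(* Let $\mathfrak{J}:\mathbb{P}^n\dashrightarrow\mathbb{P}^n$ be a generalized de Jonquières transformation with Cremona support $\mathfrak{F}:\mathbb{P}^{n-1}\dashrightarrow\mathbb{P}^{n-1}$. Then the inverse transformation $\mathfrak{J}^{-1}$ is a generalized de Jonquières transformation with Cremona support $\mathfrak{F}^{-1}$.
   Context: $k$ is an infinite field and $\mathbb{P}^m=\mathbb{P}^m_k$. A rational map $\mathbb{P}^n\dashrightarrow\mathbb{P}^m$ is written $(f_1:\cdots:f_{m+1})$ with $f_1,\ldots,f_{m+1}$ forms of the same degree in the source polynomial ring. A Cremona transformation of $\mathbb{P}^n$ is a birational map of $\mathbb{P}^n$ to itself. Source and target are distinguished by $\mathbb{P}^n_x=\mathrm{Proj}(k[x_1,\ldots,x_{n+1}])$ (source) and $\mathbb{P}^n_y=\mathrm{Proj}(k[y_1,\ldots,y_{n+1}])$ (target); similarly $\mathbb{P}^{n-1}_{x'}=\mathrm{Proj}(k[x_1,\ldots,x_n])$ and $\mathbb{P}^{n-1}_{y'}=\mathrm{Proj}(k[y_1,\ldots,y_n])$. Let $\pi_x:\mathbb{P}^n_x\dashrightarrow\mathbb{P}^{n-1}_{x'}$ and $\pi_y:\mathbb{P}^n_y\dashrightarrow\mathbb{P}^{n-1}_{y'}$ be the projections onto the first $n$ coordinates. Rational maps $\mathfrak{J}:\mathbb{P}^n_x\dashrightarrow\mathbb{P}^n_y$ and $\mathfrak{F}:\mathbb{P}^{n-1}_{x'}\dashrightarrow\mathbb{P}^{n-1}_{y'}$ are called confluent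 if $\mathfrak{F}\circ\pi_x=\pi_y\circ\mathfrak{J}$ as rational maps. The same notion is used with the roles of the $x$- and $y$-variables exchanged. A polynomial in $k[x_1,\ldots,x_{n+1}]$ is an $x_{n+1}$-monoid if its degree in $x_{n+1}$ is at most $1$ (similarly for $y_{n+1}$). Generalized de Jonquières transformation: suppose $\mathfrak{F}$ and $\mathfrak{J}$ are confluent, where $\mathfrak{F}=(g_1:\cdots:g_n)$ with $g_1,\ldots,g_n\in k[x_1,\ldots,x_n]$ forms of the same degree having no proper common factor, and $\mathfrak{J}=(fg_1:\cdots:fg_n:g)$ with $f,g\in k[x_1,\ldots,x_{n+1}]$ forms such that $\gcd(f,g)=1$. Then $\mathfrak{J}$ is called a generalized de Jonquières transformation with Cremona support $\mathfrak{F}$ if the following equivalent conditions hold: (i) $\mathfrak{J}$ is birational; (ii) $\mathfrak{F}$ is birational and $f,g$ are $x_{n+1}$-monoids, at least one of which involves $x_{n+1}$ effectively. *)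

theory Defs
  imports "HOL-Library.Poly_Mapping"
begin

text \<open>
  Polynomials in the variables with indices 0, 1, 2, ...: the variable written x_(i+1) or y_(i+1)
  in the literature has index i. The polynomial ring of P^m consists of the polynomials that only
  involve the variables with index at most m. The same indices serve for source and target of a
  rational map.
\<close>

type_synonym 'k mpoly = "(nat \<Rightarrow>\<^sub>0 nat) \<Rightarrow>\<^sub>0 'k"

definition Var :: "nat \<Rightarrow> 'k::comm_ring_1 mpoly" where
  "Var i = Poly_Mapping.single (Poly_Mapping.single i 1) 1"

definition Const :: "'k::comm_ring_1 \<Rightarrow> 'k mpoly" where
  "Const c = Poly_Mapping.single 0 c"

text \<open>Forms of degree \<open>d\<close> in the variables with index less than \<open>N\<close>; zero is a form of every degree.\<close>

definition form :: "nat \<Rightarrow> nat \<Rightarrow> 'k::comm_ring_1 mpoly \<Rightarrow> bool" where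
  "form N d p \<longleftrightarrow> (\<forall>m \<in> Poly_Mapping.keys p.
     Poly_Mapping.keys m \<subseteq> {..<N} \<and> (\<Sum>i \<in> Poly_Mapping.keys m. Poly_Mapping.lookup m i) = d)"

text \<open>Substitution of the entries of \<open>gs\<close> for the variables with index less than \<open>length gs\<close>.\<close>

definition mpoly_subst :: "'k::comm_ring_1 mpoly list \<Rightarrow> 'k mpoly \<Rightarrow> 'k mpoly" where
  "mpoly_subst gs p = (\<Sum>m \<in> Poly_Mapping.keys p. Const (Poly_Mapping.lookup p m) *
     (\<Prod>i \<in> Poly_Mapping.keys m. (gs ! i) ^ Poly_Mapping.lookup m i))"

text \<open>For polynomials over a field, the units are the nonzero constants.\<close>

definition no_proper_common_factor :: "'k::field mpoly set \<Rightarrow> bool" where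
  "no_proper_common_factor S \<longleftrightarrow> (\<forall>d. (\<forall>p \<in> S. d dvd p) \<longrightarrow> d dvd 1)"

text \<open>
  A rational map from P^n to P^m is a class of (m+1)-tuples, not identically zero, of forms of
  the same degree in n+1 variables, modulo proportionality over the function field.
\<close>

definition form_tuple :: "nat \<Rightarrow> nat \<Rightarrow> 'k::field mpoly list \<Rightarrow> bool" where
  "form_tuple n m fs \<longleftrightarrow> length fs = m + 1 \<and> (\<exists>d. \<forall>f \<in> set fs. form (n + 1) d f) \<and>
     (\<exists>f \<in> set fs. f \<noteq> 0)"

definition proportional :: "nat \<Rightarrow> nat \<Rightarrow> ('k::field mpoly list \<times> 'k mpoly list) set" where
  "proportional n m = {(fs, gs). form_tuple n m fs \<and> form_tuple n m gs \<and>
     (\<forall>i \<le> m. \<forall>j \<le> m. fs ! i * gs ! j = fs ! j * gs ! i)}"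

lemma equiv_proportional: "equiv {fs. form_tuple n m fs} (proportional n m)"
proof (rule equivI)
  show "proportional n m \<subseteq> {fs. form_tuple n m fs} \<times> {fs. form_tuple n m fs}"
    by (auto simp: proportional_def)
  show "refl_on {fs. form_tuple n m fs} (proportional n m)"
    by (auto simp: refl_on_def proportional_def mult.commute)
  show "sym (proportional n m)"
    unfolding sym_def proportional_def by (auto simp: mult.commute)
  show "trans (proportional n m)"
  proof (rule transI)
    fix fs gs hs :: "'k::field mpoly list"
    assume 1: "(fs, gs) \<in> proportional n m" and 2: "(gs, hs) \<in> proportional n m"
    from 1 obtain k where k: "k \<le> m" "gs ! k \<noteq> 0"
      by (auto simp: proportional_def form_tuple_def in_set_conv_nth less_Suc_eq_le)
    have a: "fs ! i * gs ! j = fs ! j * gs ! i" "gs ! i * hs ! j = gs ! j * hs ! i"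
      if "i \<le> m" "j \<le> m" for i j
      using 1 2 that by (auto simp: proportional_def)
    have "fs ! i * hs ! j = fs ! j * hs ! i" if ij: "i \<le> m" "j \<le> m" for i j
    proof -
      have "(gs ! k * gs ! k) * (fs ! i * hs ! j) = (fs ! i * gs ! k) * (gs ! k * hs ! j)"
        by (simp add: ac_simps)
      also have "\<dots> = (fs ! k * gs ! i) * (gs ! j * hs ! k)"
        using a[of i k] a[of k j] ij k(1) by simp
      also have "\<dots> = (fs ! k * gs ! j) * (gs ! i * hs ! k)"
        by (simp add: ac_simps)
      also have "\<dots> = (fs ! j * gs ! k) * (gs ! k * hs ! i)"
        using a[of j k] a[of k i] ij k(1) by simp
      also have "\<dots> = (gs ! k * gs ! k) * (fs ! j * hs ! i)"
        by (simp add: ac_simps)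
      finally show ?thesis
        using k(2) by simp
    qed
    then show "(fs, hs) \<in> proportional n m"
      using 1 2 by (auto simp: proportional_def)
  qed
qed

text \<open>The rational map (f_1 : ... : f_(m+1)); it is empty if \<open>fs\<close> is not a valid tuple of forms.\<close>

definition ratmap :: "nat \<Rightarrow> nat \<Rightarrow> 'k::field mpoly list \<Rightarrow> 'k mpoly list set" where
  "ratmap n m fs = proportional n m `` {fs}"

definition ratmaps :: "nat \<Rightarrow> nat \<Rightarrow> 'k::field mpoly list set set" where
  "ratmaps n m = {fs. form_tuple n m fs} // proportional n m"

text \<open>
  The composite of F from P^m to P^l after G from P^n to P^m. A choice of representatives whose
  composite vanishes identically contributes the empty set; all other choices give the same class.
  The composite is undefined as a rational map iff this set is empty, i.e. iff G maps P^n into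
  the locus where F is undefined.
\<close>

definition rat_comp ::
  "nat \<Rightarrow> nat \<Rightarrow> 'k::field mpoly list set \<Rightarrow> 'k mpoly list set \<Rightarrow> 'k mpoly list set" where
  "rat_comp n l F G = (\<Union>fs \<in> F. \<Union>gs \<in> G. ratmap n l (map (mpoly_subst gs) fs))"

definition rat_id :: "nat \<Rightarrow> 'k::field mpoly list set" where
  "rat_id n = ratmap n n (map Var [0..<n + 1])"

definition is_rat_inverse :: "nat \<Rightarrow> 'k::field mpoly list set \<Rightarrow> 'k mpoly list set \<Rightarrow> bool" where
  "is_rat_inverse n F G \<longleftrightarrow> G \<in> ratmaps n n \<and> rat_comp n n F G = rat_id n \<and> rat_comp n n G F = rat_id n"

definition cremona :: "nat \<Rightarrow> 'k::field mpoly list set \<Rightarrow> bool" where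
  "cremona n F \<longleftrightarrow> F \<in> ratmaps n n \<and> (\<exists>G. is_rat_inverse n F G)"

definition rat_inv :: "nat \<Rightarrow> 'k::field mpoly list set \<Rightarrow> 'k mpoly list set" where
  "rat_inv n F = (THE G. is_rat_inverse n F G)"

text \<open>The projection from P^n to P^(n-1) onto the first n coordinates, for \<open>n \<ge> 1\<close>.\<close>

definition rat_proj :: "nat \<Rightarrow> 'k::field mpoly list set" where
  "rat_proj n = ratmap n (n - 1) (map Var [0..<n])"

definition confluent :: "nat \<Rightarrow> 'k::field mpoly list set \<Rightarrow> 'k mpoly list set \<Rightarrow> bool" where
  "confluent n J F \<longleftrightarrow>
     rat_comp n (n - 1) F (rat_proj n) \<in> ratmaps n (n - 1) \<and>
     rat_comp n (n - 1) F (rat_proj n) = rat_comp n (n - 1) (rat_proj n) J"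

text \<open>
  \<open>J\<close> is a generalized de Jonquieres transformation of P^n with Cremona support \<open>F\<close>. The last
  conjunct is birationality of \<open>J\<close>; in the presence of the others it is equivalent to birationality
  of \<open>F\<close> together with \<open>f\<close> and \<open>g\<close> having degree at most 1 in the last variable, not both degree 0.
\<close>

definition gen_de_jonquieres ::
  "nat \<Rightarrow> 'k::field mpoly list set \<Rightarrow> 'k mpoly list set \<Rightarrow> bool" where
  "gen_de_jonquieres n J F \<longleftrightarrow>
     J \<in> ratmaps n n \<and> F \<in> ratmaps (n - 1) (n - 1) \<and> confluent n J F \<and>
     (\<exists>gs f g. form_tuple (n - 1) (n - 1) gs \<and> no_proper_common_factor (set gs) \<and>
        F = ratmap (n - 1) (n - 1) gs \<and>
        (\<exists>d. form (n + 1) d f) \<and> (\<exists>d. form (n + 1) d g) \<and> no_proper_common_factor {f, g} \<and>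
        form_tuple n n (map (\<lambda>h. f * h) gs @ [g]) \<and>
        J = ratmap n n (map (\<lambda>h. f * h) gs @ [g])) \<and>
     cremona n J"

end

theory Submission
  imports Defs "HOL-Computational_Algebra.Polynomial"
begin

text \<open>
  Let \<open>k\<close> represent the inverse of \<open>J = (f g_1 : ... : f g_n : g)\<close> and expand
  \<open>k_i = sum_r a_(i,r) y_(n+1)^r\<close> for \<open>i \<le> n\<close>. From \<open>k_i(J) x_j = k_j(J) x_i\<close> one gets
  \<open>sum_r f^(D-r) g^r (a_(i,r)(g_1, ..., g_n) x_j - a_(j,r)(g_1, ..., g_n) x_i) = 0\<close>, and since \<open>f/g\<close>
  is transcendental over the field of fractions of \<open>k[x_1, ..., x_n]\<close>, every summand vanishes. So any
  nonzero row \<open>p = (a_(1,r), ..., a_(n,r))\<close> represents an inverse of \<open>F\<close>, and all rows are proportional,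
  whence \<open>(k_1, ..., k_n)\<close> is proportional to \<open>p\<close>. Thus \<open>J\<close> has the inverse
  \<open>(k_1 p_1 : ... : k_1 p_n : p_1 k_(n+1))\<close>; cancelling common factors of \<open>p\<close> and of the pair
  \<open>k_1, p_1 k_(n+1)\<close> gives the required shape.
\<close>

subsection \<open>Evaluation homomorphisms and forms\<close>

text \<open>The vanishing of the summands yields identities between values at (g_1, ..., g_n) only.
  They lift to the coefficient forms because no nonzero form in n variables vanishes at (g_1, ...,
  g_n), and this comes from the other composite, J after its inverse. The lifting gives the
  proportionality of the rows, and also the second of the two composites that make p an inverse of
  F.

  The factor p_1 in the final tuple comes from k_1 p_i = p_1 k_i for i <= n: multiplying k by p_1 is
  what puts the single factor k_1 in front of the first n entries.

  Fractions are avoided: proportionality is stated by cross products, and transcendence of f/g by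
  the absence of nontrivial homogeneous relations between f and g. A separate obstacle is
  \<open>rat_comp\<close>, a union over all representatives: an equation with \<open>rat_id\<close>
  speaks of some representatives only, and moving it to chosen ones requires that their composite
  does not vanish, which is dominance again.\<close>

locale unital_hom =
  fixes H :: "'a::comm_ring_1 \<Rightarrow> 'b::comm_ring_1"
  assumes hom_one: "H 1 = 1"
    and hom_add: "H (x + y) = H x + H y"
    and hom_mult: "H (x * y) = H x * H y"
begin

lemma hom_zero: "H 0 = 0"
  using hom_add[of 0 0] by simp

lemma hom_uminus: "H (- x) = - H x"
  using hom_add[of x "- x"] by (simp add: hom_zero eq_neg_iff_add_eq_0 add.commute)

lemma hom_diff: "H (x - y) = H x - H y"
  using hom_add[of x "- y"] by (simp add: hom_uminus)

lemma hom_sum: "H (sum g S) = (\<Sum>x\<in>S. H (g x))"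
  by (induction S rule: infinite_finite_induct) (auto simp: hom_zero hom_add)

lemma hom_prod: "H (prod g S) = (\<Prod>x\<in>S. H (g x))"
  by (induction S rule: infinite_finite_induct) (auto simp: hom_one hom_mult)

lemma hom_power: "H (x ^ n) = H x ^ n"
  by (induction n) (auto simp: hom_one hom_mult)

end

text \<open>The target ring is left open because substitution is only one use:
  \<open>weight_poly\<close> and \<open>last_var_poly\<close> are evaluations in univariate
  polynomials over the polynomial ring.\<close>

definition mpoly_eval ::
  "('k::comm_ring_1 \<Rightarrow> 'r::comm_ring_1) \<Rightarrow> (nat \<Rightarrow> 'r) \<Rightarrow> 'k mpoly \<Rightarrow> 'r" where
  "mpoly_eval c \<phi> p = (\<Sum>m \<in> Poly_Mapping.keys p. c (Poly_Mapping.lookup p m) *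
     (\<Prod>i \<in> Poly_Mapping.keys m. \<phi> i ^ Poly_Mapping.lookup m i))"

lemma mpoly_subst_eq_eval: "mpoly_subst gs = mpoly_eval Const ((!) gs)"
  by (rule ext) (simp add: mpoly_subst_def mpoly_eval_def)

lemma monomial_eval_superset:
  assumes "finite S" "Poly_Mapping.keys m \<subseteq> S"
  shows "(\<Prod>i \<in> Poly_Mapping.keys m. (\<phi> i :: 'r::comm_ring_1) ^ Poly_Mapping.lookup m i)
    = (\<Prod>i\<in>S. \<phi> i ^ Poly_Mapping.lookup m i)"
  by (rule prod.mono_neutral_left[OF assms]) (auto simp: in_keys_iff)

lemma monomial_eval_add:
  fixes \<phi> :: "nat \<Rightarrow> 'r::comm_ring_1"
  shows "(\<Prod>i \<in> Poly_Mapping.keys (m + m'). \<phi> i ^ Poly_Mapping.lookup (m + m') i)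
    = (\<Prod>i \<in> Poly_Mapping.keys m. \<phi> i ^ Poly_Mapping.lookup m i)
    * (\<Prod>i \<in> Poly_Mapping.keys m'. \<phi> i ^ Poly_Mapping.lookup m' i)"
proof -
  define S where "S = Poly_Mapping.keys m \<union> Poly_Mapping.keys m'"
  have S: "finite S" "Poly_Mapping.keys m \<subseteq> S" "Poly_Mapping.keys m' \<subseteq> S"
    "Poly_Mapping.keys (m + m') \<subseteq> S"
    using keys_add[of m m'] by (auto simp: S_def)
  show ?thesis
    unfolding monomial_eval_superset[OF S(1,2)] monomial_eval_superset[OF S(1,3)]
      monomial_eval_superset[OF S(1,4)]
    by (simp add: lookup_add power_add prod.distrib)
qed

lemma sum_single_keys:
  "(\<Sum>m \<in> Poly_Mapping.keys p. Poly_Mapping.single m (Poly_Mapping.lookup p m)) = p"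
proof (rule poly_mapping_eqI)
  fix k
  have "Poly_Mapping.lookup (\<Sum>m \<in> Poly_Mapping.keys p. Poly_Mapping.single m (Poly_Mapping.lookup p m)) k
      = (\<Sum>m \<in> Poly_Mapping.keys p. if m = k then Poly_Mapping.lookup p k else 0)"
    unfolding lookup_sum by (intro sum.cong) (auto simp: lookup_single when_def)
  also have "\<dots> = Poly_Mapping.lookup p k"
    by (simp add: sum.delta in_keys_iff)
  finally show "Poly_Mapping.lookup (\<Sum>m \<in> Poly_Mapping.keys p.
      Poly_Mapping.single m (Poly_Mapping.lookup p m)) k = Poly_Mapping.lookup p k" .
qed

lemma unital_hom_mpoly_eval:
  assumes "unital_hom c"
  shows "unital_hom (mpoly_eval c \<phi>)"
proof -
  interpret c: unital_hom c by fact
  let ?M = "\<lambda>m. \<Prod>i \<in> Poly_Mapping.keys m. \<phi> i ^ Poly_Mapping.lookup m i"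
  have add: "mpoly_eval c \<phi> (p + q) = mpoly_eval c \<phi> p + mpoly_eval c \<phi> q" for p q
    unfolding mpoly_eval_def
    by (rule setsum_keys_plus_distrib) (auto simp: c.hom_zero c.hom_add algebra_simps)
  have zero: "mpoly_eval c \<phi> 0 = 0"
    by (simp add: mpoly_eval_def)
  have sum: "mpoly_eval c \<phi> (sum g S) = (\<Sum>x\<in>S. mpoly_eval c \<phi> (g x))" for g and S :: "(nat \<Rightarrow>\<^sub>0 nat) set"
    by (induction S rule: infinite_finite_induct) (auto simp: add zero)
  have single: "mpoly_eval c \<phi> (Poly_Mapping.single m a) = c a * ?M m" for m a
    by (simp add: mpoly_eval_def c.hom_zero)
  have "mpoly_eval c \<phi> (p * q) = mpoly_eval c \<phi> p * mpoly_eval c \<phi> q" for p q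
  proof -
    have "p * q = (\<Sum>m \<in> Poly_Mapping.keys p. Poly_Mapping.single m (Poly_Mapping.lookup p m)) *
      (\<Sum>m' \<in> Poly_Mapping.keys q. Poly_Mapping.single m' (Poly_Mapping.lookup q m'))"
      by (simp only: sum_single_keys)
    also have "\<dots> = (\<Sum>m \<in> Poly_Mapping.keys p. \<Sum>m' \<in> Poly_Mapping.keys q.
        Poly_Mapping.single (m + m') (Poly_Mapping.lookup p m * Poly_Mapping.lookup q m'))"
      by (simp add: sum_product mult_single)
    also have "mpoly_eval c \<phi> \<dots> = (\<Sum>m \<in> Poly_Mapping.keys p. \<Sum>m' \<in> Poly_Mapping.keys q.
        (c (Poly_Mapping.lookup p m) * ?M m) * (c (Poly_Mapping.lookup q m') * ?M m'))"
      by (simp add: sum single c.hom_mult monomial_eval_add mult_ac)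
    also have "\<dots> = mpoly_eval c \<phi> p * mpoly_eval c \<phi> q"
      by (simp add: mpoly_eval_def sum_product)
    finally show ?thesis .
  qed
  moreover have "mpoly_eval c \<phi> 1 = 1"
    using single[of 0 1] by (simp add: c.hom_one)
  ultimately show ?thesis
    by unfold_locales (auto simp: add)
qed

lemma unital_hom_Const: "unital_hom (Const :: 'k::comm_ring_1 \<Rightarrow> _)"
  by unfold_locales (auto simp: Const_def single_add mult_single)

lemma unital_hom_mpoly_subst: "unital_hom (mpoly_subst gs)"
  unfolding mpoly_subst_eq_eval by (intro unital_hom_mpoly_eval unital_hom_Const)

text \<open>Nested evaluations are merged by this rule, for instance in
  \<open>mpoly_subst_mpoly_subst\<close> and \<open>poly_last_var_poly\<close>.\<close>

lemma hom_mpoly_eval: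
  assumes "unital_hom H"
  shows "H (mpoly_eval c \<phi> p) = mpoly_eval (\<lambda>a. H (c a)) (\<lambda>i. H (\<phi> i)) p"
proof -
  interpret unital_hom H by fact
  show ?thesis
    by (simp add: mpoly_eval_def hom_sum hom_prod hom_mult hom_power)
qed

lemma Var_power: "Var i ^ k = Poly_Mapping.single (Poly_Mapping.single i k) 1"
proof (induction k)
  case (Suc k)
  then show ?case
    by (simp add: Var_def mult_single flip: single_add)
qed simp

lemma prod_single_one:
  "(\<Prod>i\<in>S. Poly_Mapping.single (s i) (1::'k::comm_ring_1)) = Poly_Mapping.single (\<Sum>i\<in>S. s i) 1"
  by (induction S rule: infinite_finite_induct) (auto simp: mult_single)

lemma prod_Var_power:
  "(\<Prod>i \<in> Poly_Mapping.keys m. Var i ^ Poly_Mapping.lookup m i) = Poly_Mapping.single m 1"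
  unfolding Var_power prod_single_one sum_single_keys ..

lemma mpoly_eval_Const_Var: "mpoly_eval Const Var p = p"
  by (simp add: mpoly_eval_def prod_Var_power Const_def mult_single sum_single_keys)

lemma mpoly_eval_Const: 
  assumes "unital_hom c"
  shows "mpoly_eval c \<phi> (Const a) = c a"
proof -
  interpret unital_hom c by fact
  show ?thesis by (simp add: mpoly_eval_def Const_def hom_zero)
qed

lemma mpoly_eval_Var: 
  assumes "unital_hom c"
  shows "mpoly_eval c \<phi> (Var i) = \<phi> i"
proof -
  interpret unital_hom c by fact
  show ?thesis by (simp add: mpoly_eval_def Var_def hom_one)
qed

text \<open>The entry \<open>gs ! i\<close> is unspecified beyond the end of the list. A form in
  \<open>N\<close> variables never reads those entries, so lists and functions can be exchanged
  freely.\<close>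

lemma mpoly_eval_cong_form:
  assumes "form N d p" "\<And>i. i < N \<Longrightarrow> \<phi> i = \<psi> i"
  shows "mpoly_eval c \<phi> p = mpoly_eval c \<psi> p"
  unfolding mpoly_eval_def
  by (intro sum.cong arg_cong2[where f = "(*)"] prod.cong refl)
    (use assms in \<open>auto simp: form_def subset_iff\<close>)

lemma mpoly_subst_Var:
  assumes "form N d p"
  shows "mpoly_subst (map Var [0..<N]) p = p"
proof -
  have "mpoly_subst (map Var [0..<N]) p = mpoly_eval Const Var p"
    unfolding mpoly_subst_eq_eval by (rule mpoly_eval_cong_form[OF assms]) simp
  then show ?thesis by (simp add: mpoly_eval_Const_Var)
qed

lemma mpoly_subst_Var_index: "mpoly_subst gs (Var i) = gs ! i"
  unfolding mpoly_subst_eq_eval by (rule mpoly_eval_Var[OF unital_hom_Const])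

lemma mpoly_subst_mpoly_subst:
  assumes "form N d p" "N \<le> length gs"
  shows "mpoly_subst hs (mpoly_subst gs p) = mpoly_subst (map (mpoly_subst hs) gs) p"
proof -
  have "mpoly_subst hs (mpoly_eval Const ((!) gs) p)
      = mpoly_eval (\<lambda>a. mpoly_subst hs (Const a)) (\<lambda>i. mpoly_subst hs (gs ! i)) p"
    by (rule hom_mpoly_eval[OF unital_hom_mpoly_subst])
  also have "(\<lambda>a. mpoly_subst hs (Const a)) = Const"
    unfolding mpoly_subst_eq_eval by (rule ext) (rule mpoly_eval_Const[OF unital_hom_Const])
  also have "mpoly_eval Const (\<lambda>i. mpoly_subst hs (gs ! i)) p
      = mpoly_eval Const ((!) (map (mpoly_subst hs) gs)) p"
    by (rule mpoly_eval_cong_form[OF assms(1)]) (use assms(2) in auto)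
  finally show ?thesis by (simp add: mpoly_subst_eq_eval)
qed

lemma mpoly_eval_scale:
  assumes "form N d p"
  shows "mpoly_eval c (\<lambda>i. l * \<phi> i) p = l ^ d * mpoly_eval c \<phi> p"
proof -
  have "(\<Prod>i \<in> Poly_Mapping.keys m. (l * \<phi> i) ^ Poly_Mapping.lookup m i)
    = l ^ d * (\<Prod>i \<in> Poly_Mapping.keys m. \<phi> i ^ Poly_Mapping.lookup m i)"
    if "m \<in> Poly_Mapping.keys p" for m
  proof -
    have "(\<Sum>i \<in> Poly_Mapping.keys m. Poly_Mapping.lookup m i) = d"
      using assms that by (auto simp: form_def)
    then show ?thesis
      by (simp add: power_mult_distrib prod.distrib flip: power_sum)
  qed
  then show ?thesis
    by (simp add: mpoly_eval_def sum_distrib_left mult_ac)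
qed

lemma mpoly_subst_scale:
  assumes "form N d p" "N \<le> length gs"
  shows "mpoly_subst (map (\<lambda>h. l * h) gs) p = l ^ d * mpoly_subst gs p"
proof -
  have "mpoly_subst (map (\<lambda>h. l * h) gs) p = mpoly_eval Const (\<lambda>i. l * gs ! i) p"
    unfolding mpoly_subst_eq_eval
    by (rule mpoly_eval_cong_form[OF assms(1)]) (use assms(2) in auto)
  then show ?thesis
    by (simp add: mpoly_eval_scale[OF assms(1)] mpoly_subst_eq_eval)
qed

text \<open>Homogeneity without denominators: \<open>vs\<close> is v/u times \<open>us\<close> on
  the relevant entries, so the values at a form of degree \<open>d\<close> differ by the
  \<open>d\<close>-th power of v/u.\<close>

lemma mpoly_subst_proportional:
  assumes "form N d p" "N \<le> length us" "N \<le> length vs"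
    and "\<And>i. i < N \<Longrightarrow> u * vs ! i = v * us ! i"
  shows "u ^ d * mpoly_subst vs p = v ^ d * mpoly_subst us p"
proof -
  have "mpoly_eval Const (\<lambda>i. u * vs ! i) p = mpoly_eval Const (\<lambda>i. v * us ! i) p"
    by (rule mpoly_eval_cong_form[OF assms(1)]) (use assms(4) in auto)
  then show ?thesis
    by (simp add: mpoly_eval_scale[OF assms(1)] mpoly_subst_eq_eval)
qed

lemma form_zero [simp]: "form N d 0"
  by (simp add: form_def)

lemma form_add: "form N d p \<Longrightarrow> form N d q \<Longrightarrow> form N d (p + q)"
  using keys_add[of p q] by (fastforce simp: form_def)

lemma keys_uminus_mpoly: "Poly_Mapping.keys (- p :: 'k::comm_ring_1 mpoly) = Poly_Mapping.keys p"
  by (auto simp: in_keys_iff)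

lemma form_uminus: "form N d p \<Longrightarrow> form N d (- p)"
  by (simp add: form_def keys_uminus_mpoly)

lemma form_diff: "form N d p \<Longrightarrow> form N d q \<Longrightarrow> form N d (p - q)"
  using form_add[of N d p "- q"] by (simp add: form_uminus)

lemma form_sum: "(\<And>x. x \<in> S \<Longrightarrow> form N d (g x)) \<Longrightarrow> form N d (sum g S)"
  by (induction S rule: infinite_finite_induct) (auto intro: form_add)

lemma monomial_degree_add:
  "(\<Sum>i \<in> Poly_Mapping.keys (m + m'). Poly_Mapping.lookup (m + m') i)
    = (\<Sum>i \<in> Poly_Mapping.keys m. Poly_Mapping.lookup m i)
    + (\<Sum>i \<in> Poly_Mapping.keys m'. (Poly_Mapping.lookup m' i :: nat))"
  by (rule setsum_keys_plus_distrib) auto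

lemma form_mult:
  assumes "form N d p" "form N e q"
  shows "form N (d + e) (p * q)"
  unfolding form_def
proof
  fix m assume "m \<in> Poly_Mapping.keys (p * q)"
  then obtain a b where ab: "m = a + b" "a \<in> Poly_Mapping.keys p" "b \<in> Poly_Mapping.keys q"
    using keys_mult[of p q] by blast
  then show "Poly_Mapping.keys m \<subseteq> {..<N} \<and> (\<Sum>i \<in> Poly_Mapping.keys m. Poly_Mapping.lookup m i) = d + e"
    using assms keys_add[of a b] unfolding ab(1) monomial_degree_add
    by (auto simp: form_def) blast
qed

lemma form_Const: "form N 0 (Const a)"
  by (simp add: form_def Const_def)

lemma form_one: "form N 0 1"
  using form_Const[of N 1] by (simp add: Const_def)

lemma form_Var: "i < N \<Longrightarrow> form N 1 (Var i)"
  by (simp add: form_def Var_def)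

lemma form_power: "form N d p \<Longrightarrow> form N (k * d) (p ^ k)"
  by (induction k) (auto intro: form_one form_mult)

lemma form_prod:
  "(\<And>x. x \<in> S \<Longrightarrow> form N (d x) (g x)) \<Longrightarrow> form N (sum d S) (prod g S)"
  by (induction S rule: infinite_finite_induct) (auto intro: form_one form_mult)

lemma form_mono: "form N d p \<Longrightarrow> N \<le> N' \<Longrightarrow> form N' d p"
  by (fastforce simp: form_def)

lemma form_degree_unique: "form N d p \<Longrightarrow> form N' d' p \<Longrightarrow> p \<noteq> 0 \<Longrightarrow> d = d'"
  by (metis (no_types, lifting) form_def keys_eq_empty ex_in_conv)

lemma form_mpoly_subst:
  assumes "form N d p" "\<And>i. i < N \<Longrightarrow> form N' e (gs ! i)"
  shows "form N' (d * e) (mpoly_subst gs p)"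
  unfolding mpoly_subst_def
proof (rule form_sum)
  fix m assume m: "m \<in> Poly_Mapping.keys p"
  have "form N' (\<Sum>i \<in> Poly_Mapping.keys m. Poly_Mapping.lookup m i * e)
      (\<Prod>i \<in> Poly_Mapping.keys m. (gs ! i) ^ Poly_Mapping.lookup m i)"
    by (intro form_prod form_power assms(2)) (use m assms(1) in \<open>auto simp: form_def\<close>)
  moreover have "(\<Sum>i \<in> Poly_Mapping.keys m. Poly_Mapping.lookup m i * e) = d * e"
    using m assms(1) by (auto simp: form_def simp flip: sum_distrib_right)
  ultimately show "form N' (d * e) (Const (Poly_Mapping.lookup p m) *
      (\<Prod>i \<in> Poly_Mapping.keys m. (gs ! i) ^ Poly_Mapping.lookup m i))"
    using form_mult[OF form_Const] by fastforce
qed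

subsection \<open>Homogeneous relations between two polynomials\<close>

lemma smult_sum_right: "smult a (\<Sum>i\<in>S. p i) = (\<Sum>i\<in>S. smult a (p i))"
  by (induction S rule: infinite_finite_induct) (auto simp: smult_add_right)

text \<open>All summands but the one with r = 0 contain the factor \<open>h\<close>, and since
  \<open>h\<close> has smaller degree than \<open>f\<close>, they cannot reach the degree of the
  pure power of \<open>f\<close>. Hence c 0 = 0, and cancelling \<open>h\<close> leaves a relation
  with \<open>D\<close> lowered by one.\<close>

lemma homogeneous_relation_degree_less:
  fixes f h :: "'a::idom poly"
  assumes "h \<noteq> 0" "degree h < degree f"
    and "(\<Sum>r\<le>D. smult (c r) (f ^ (D - r) * h ^ r)) = 0" "r \<le> D"
  shows "c r = 0"
  using assms(3,4)
proof (induction D arbitrary: c r)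
  case (Suc D)
  let ?T = "\<Sum>r\<le>D. smult (c (Suc r)) (f ^ (D - r) * h ^ r)"
  have split: "smult (c 0) (f ^ Suc D) + h * ?T = 0"
    using Suc.prems(1)
    by (simp add: sum.atMost_Suc_shift sum_distrib_left mult_ac del: sum.atMost_Suc)
  have "degree (smult (c (Suc r)) (f ^ (D - r) * h ^ r)) \<le> D * degree f" if "r \<le> D" for r
  proof -
    have "degree (f ^ (D - r) * h ^ r) \<le> (D - r) * degree f + r * degree h"
      by (intro order.trans[OF degree_mult_le] add_mono)
        (metis degree_power_le mult.commute)+
    also have "\<dots> \<le> (D - r) * degree f + r * degree f"
      using assms(2) by simp
    also have "\<dots> = D * degree f"
      using that by (simp flip: add_mult_distrib)
    finally show ?thesis
      using degree_smult_le order.trans by blast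
  qed
  then have T: "degree ?T \<le> D * degree f"
    by (intro degree_sum_le) auto
  have "c 0 = 0"
  proof (rule ccontr)
    assume "c 0 \<noteq> 0"
    have "f \<noteq> 0" using assms(2) by auto
    have "degree (smult (c 0) (f ^ Suc D)) = Suc D * degree f"
      using \<open>c 0 \<noteq> 0\<close> \<open>f \<noteq> 0\<close> by (simp add: degree_power_eq del: power_Suc)
    moreover have "degree (smult (c 0) (f ^ Suc D)) = degree (h * ?T)"
      using split by (metis add_eq_0_iff degree_minus)
    moreover have "degree (h * ?T) < Suc D * degree f"
      using degree_mult_le[of h ?T] T assms(2) by simp
    ultimately show False by simp
  qed
  then have "?T = 0"
    using split assms(1) by simp
  then have "\<forall>r\<le>D. c (Suc r) = 0"
    using Suc.IH[of "\<lambda>r. c (Suc r)"] by blast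
  with \<open>c 0 = 0\<close> Suc.prems(2) show ?case
    by (cases r) auto
qed simp

text \<open>Two polynomials of the same degree: replacing \<open>g\<close> by \<open>a g - b f\<close>, with the
  leading coefficients as factors, lowers the degree and changes the coefficients of the relation
  by an invertible triangular matrix.\<close>

lemma homogeneous_relation_degree_eq:
  fixes f g :: "'a::idom poly"
  defines "a \<equiv> lead_coeff f" and "b \<equiv> lead_coeff g"
  assumes "f \<noteq> 0" "degree f = degree g" "smult a g \<noteq> smult b f"
    and rel: "(\<Sum>r\<le>D. smult (c r) (f ^ (D - r) * g ^ r)) = 0" and "r \<le> D"
  shows "c r = 0"
proof -
  define h where "h = smult a g - smult b f"
  have a: "a \<noteq> 0"
    using assms(3) by (simp add: a_def)
  have "h \<noteq> 0"
    using assms(5) by (simp add: h_def)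
  have "degree h \<le> degree f"
    unfolding h_def using assms(4) degree_smult_le by (metis degree_diff_le)
  moreover have "coeff h (degree f) = 0"
    using assms(4) by (simp add: h_def a_def b_def)
  ultimately have "degree h < degree f"
    using \<open>h \<noteq> 0\<close> by (metis le_neq_implies_less leading_coeff_0_iff)
  \<comment> \<open>Coefficient of f^(D-s) h^s after multiplying the relation by a^D and expanding
    (a g)^r = (h + b f)^r. The binomial vanishes for r < s, so the truncated exponent r - s does no
    harm.\<close>
  define c' where "c' s = (\<Sum>r\<le>D. c r * a ^ (D - r) * of_nat (r choose s) * b ^ (r - s))" for s
  have ag: "smult a g = h + smult b f"
    by (simp add: h_def)
  have "(\<Sum>s\<le>D. smult (c' s) (f ^ (D - s) * h ^ s))
      = (\<Sum>s\<le>D. \<Sum>r\<le>D. smult (c r * a ^ (D - r) * of_nat (r choose s) * b ^ (r - s)) (f ^ (D - s) * h ^ s))"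
    by (simp add: c'_def smult_sum)
  also have "\<dots> = (\<Sum>r\<le>D. \<Sum>s\<le>D. smult (c r * a ^ (D - r) * of_nat (r choose s) * b ^ (r - s)) (f ^ (D - s) * h ^ s))"
    by (rule sum.swap)
  also have "\<dots> = (\<Sum>r\<le>D. smult (a ^ D) (smult (c r) (f ^ (D - r) * g ^ r)))"
  proof (rule sum.cong[OF refl])
    fix r assume "r \<in> {..D}"
    then have r: "r \<le> D" by simp
    have "(\<Sum>s\<le>D. smult (c r * a ^ (D - r) * of_nat (r choose s) * b ^ (r - s)) (f ^ (D - s) * h ^ s))
      = (\<Sum>s\<le>r. smult (c r * a ^ (D - r) * of_nat (r choose s) * b ^ (r - s)) (f ^ (D - s) * h ^ s))"
      by (rule sum.mono_neutral_right) (use r in \<open>auto simp: binomial_eq_0\<close>)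
    also have "\<dots> = (\<Sum>s\<le>r. smult (c r * a ^ (D - r)) (f ^ (D - r) *
        (of_nat (r choose s) * h ^ s * (smult b f) ^ (r - s))))"
    proof (rule sum.cong[OF refl])
      fix s assume "s \<in> {..r}"
      then have "f ^ (D - s) = f ^ (D - r) * f ^ (r - s)"
        using r by (simp flip: power_add)
      then show "smult (c r * a ^ (D - r) * of_nat (r choose s) * b ^ (r - s)) (f ^ (D - s) * h ^ s)
        = smult (c r * a ^ (D - r)) (f ^ (D - r) *
          (of_nat (r choose s) * h ^ s * (smult b f) ^ (r - s)))"
        by (simp add: smult_power of_nat_poly mult_ac)
    qed
    also have "\<dots> = smult (c r * a ^ (D - r)) (f ^ (D - r) * (h + smult b f) ^ r)"
      by (simp add: binomial_ring sum_distrib_left smult_sum_right)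
    also have "\<dots> = smult (c r * (a ^ (D - r) * a ^ r)) (f ^ (D - r) * g ^ r)"
      by (simp add: smult_power mult_ac flip: ag)
    also have "\<dots> = smult (a ^ D) (smult (c r) (f ^ (D - r) * g ^ r))"
      using r by (simp add: mult.commute flip: power_add)
    finally show "(\<Sum>s\<le>D. smult (c r * a ^ (D - r) * of_nat (r choose s) * b ^ (r - s)) (f ^ (D - s) * h ^ s))
      = smult (a ^ D) (smult (c r) (f ^ (D - r) * g ^ r))" .
  qed
  also have "\<dots> = 0"
    by (simp only: rel smult_0_right flip: smult_sum_right)
  finally have c': "c' s = 0" if "s \<le> D" for s
    using homogeneous_relation_degree_less \<open>h \<noteq> 0\<close> \<open>degree h < degree f\<close> that by blast
  \<comment> \<open>Downward induction on \<open>r\<close> inverts the triangular system: c' r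
    involves only c i with i at least r, and its diagonal entry is a^(D-r), as r choose r is 1. No
    division by binomials occurs, so every characteristic is covered.\<close>
  show "c r = 0"
    using \<open>r \<le> D\<close>
  proof (induction "D - r" arbitrary: r rule: less_induct)
    case less
    have "c' r = (\<Sum>s\<in>{r}. c s * a ^ (D - s) * of_nat (s choose r) * b ^ (s - r))"
      unfolding c'_def
    proof (rule sum.mono_neutral_right)
      show "\<forall>i\<in>{..D} - {r}. c i * a ^ (D - i) * of_nat (i choose r) * b ^ (i - r) = 0"
      proof
        fix i assume i: "i \<in> {..D} - {r}"
        show "c i * a ^ (D - i) * of_nat (i choose r) * b ^ (i - r) = 0"
        proof (cases "i < r")
          case False
          then have "c i = 0" using i less.hyps[of i] by force
          then show ?thesis by simp
        qed (simp add: binomial_eq_0)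
      qed
    qed (use less.prems in auto)
    then show ?case
      using c'[OF less.prems] a by simp
  qed
qed

text \<open>A multiple of \<open>f\<close> by a fraction of coefficients can equal \<open>g\<close>
  only if the factor is the quotient of the leading coefficients. The third assumption thus says
  that f/g is not constant over the fraction field, and a nonconstant rational function is
  transcendental.\<close>

lemma homogeneous_relation_trivial:
  fixes f g :: "'a::idom poly"
  assumes "f \<noteq> 0" "g \<noteq> 0" "smult (lead_coeff f) g \<noteq> smult (lead_coeff g) f"
    and rel: "(\<Sum>r\<le>D. smult (c r) (f ^ (D - r) * g ^ r)) = 0" and "r \<le> D"
  shows "c r = 0"
proof (cases "degree f" "degree g" rule: linorder_cases)
  case less
  \<comment> \<open>Reading the sum backwards exchanges the roles of \<open>f\<close> and
    \<open>g\<close>.\<close>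
  have "(\<Sum>r\<le>D. smult (c (D - r)) (g ^ (D - r) * f ^ r))
      = (\<Sum>r\<le>D. smult (c r) (f ^ (D - r) * g ^ r))"
    by (rule sum.reindex_bij_witness[of _ "\<lambda>r. D - r" "\<lambda>r. D - r"]) (auto simp: mult.commute)
  then have "c (D - (D - r)) = 0"
    using homogeneous_relation_degree_less[OF assms(1) less, where c = "\<lambda>r. c (D - r)" and r = "D - r"] rel
    by simp
  then show ?thesis using assms(5) by simp
next
  case equal
  then show ?thesis
    using homogeneous_relation_degree_eq assms by blast
next
  case greater
  then show ?thesis
    using homogeneous_relation_degree_less assms by blast
qed

subsection \<open>Factors of forms\<close>

text \<open>Order at 0 and degree are both additive, the order is at most the degree, and the two
  agree for a nonzero monomial. So they agree for each factor, which makes the factor a constant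
  times a power of the variable.\<close>

lemma factor_of_monom:
  fixes f g :: "'a::idom poly"
  assumes "f * g = monom c d" "c \<noteq> 0"
  obtains a k where "f = monom a k"
proof -
  have nz: "f * g \<noteq> 0"
    using assms by simp
  have "order 0 f + order 0 g = d"
    using order_mult[OF nz, of 0] assms by (simp add: order_0_monom)
  moreover have "degree f + degree g = d"
    using degree_mult_eq[of f g] nz assms by (metis degree_monom_eq mult_eq_0_iff)
  moreover have "order 0 f \<le> degree f" "order 0 g \<le> degree g"
    using nz by (auto intro: order_degree)
  ultimately have "order 0 f = degree f"
    by linarith
  then have "[:- 0, 1:] ^ degree f dvd f"
    using order_1[of 0 f] by simp
  then obtain q where q: "f = [:0, 1:] ^ degree f * q"
    by (auto elim: dvdE)
  then have "degree f = degree ([:0, 1:] ^ degree f :: 'a poly) + degree q"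
    using nz by (metis degree_mult_eq mult_eq_0_iff)
  then have "degree q = 0"
    by (simp add: degree_linear_power)
  then obtain a where "q = [:a:]"
    by (meson degree_eq_zeroE)
  then have "f = monom a (degree f)"
    using q by (simp add: monom_altdef)
  then show thesis by (rule that)
qed

definition weight :: "(nat \<Rightarrow> nat) \<Rightarrow> (nat \<Rightarrow>\<^sub>0 nat) \<Rightarrow> nat" where
  "weight w m = (\<Sum>i \<in> Poly_Mapping.keys m. w i * Poly_Mapping.lookup m i)"

text \<open>The usual grading device: x_i is replaced by x_i t^(w i), and the new variable t records
  the weight.\<close>

definition weight_poly :: "(nat \<Rightarrow> nat) \<Rightarrow> 'k::comm_ring_1 mpoly \<Rightarrow> 'k mpoly poly" where
  "weight_poly w = mpoly_eval (\<lambda>a. [:Const a:]) (\<lambda>i. monom (Var i) (w i))"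

lemma unital_hom_pCons: "unital_hom (\<lambda>x. [:x:])"
  by unfold_locales auto

lemma unital_hom_Const_pCons: "unital_hom (\<lambda>a::'k::comm_ring_1. [:Const a:])"
proof -
  interpret unital_hom "Const :: 'k \<Rightarrow> _" by (rule unital_hom_Const)
  show ?thesis
    by unfold_locales (auto simp: hom_one hom_add hom_mult)
qed

lemma prod_monom: "(\<Prod>i\<in>S. monom (a i) (k i)) = monom (\<Prod>i\<in>S. a i) (\<Sum>i\<in>S. k i)"
  by (induction S rule: infinite_finite_induct) (auto simp: mult_monom one_poly_eq_simps)

lemma sum_monom: "(\<Sum>i\<in>S. monom (a i) d) = monom (\<Sum>i\<in>S. a i) d"
  by (induction S rule: infinite_finite_induct) (auto simp: add_monom)

lemma weight_poly_eq:
  "weight_poly w p = (\<Sum>m \<in> Poly_Mapping.keys p.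
     monom (Poly_Mapping.single m (Poly_Mapping.lookup p m)) (weight w m))"
  unfolding weight_poly_def mpoly_eval_def weight_def
  by (intro sum.cong refl)
    (simp add: monom_power prod_monom prod_Var_power smult_monom Const_def mult_single)

lemma weight_poly_eq_monom:
  assumes "\<And>m. m \<in> Poly_Mapping.keys p \<Longrightarrow> weight w m = d"
  shows "weight_poly w p = monom p d"
proof -
  have "weight_poly w p = (\<Sum>m \<in> Poly_Mapping.keys p.
     monom (Poly_Mapping.single m (Poly_Mapping.lookup p m)) d)"
    unfolding weight_poly_eq by (rule sum.cong) (auto simp: assms)
  also have "\<dots> = monom (\<Sum>m \<in> Poly_Mapping.keys p. Poly_Mapping.single m (Poly_Mapping.lookup p m)) d"
    by (simp add: sum_monom)
  finally show ?thesis by (simp add: sum_single_keys)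
qed

text \<open>Nothing can cancel: every monomial of \<open>p\<close> survives unchanged in the
  coefficient belonging to its own weight.\<close>

lemma weight_eq_if_weight_poly_eq_monom:
  assumes "weight_poly w p = monom P d" "m \<in> Poly_Mapping.keys p"
  shows "weight w m = d"
proof (rule ccontr)
  assume ne: "weight w m \<noteq> d"
  have "Poly_Mapping.lookup (coeff (weight_poly w p) (weight w m)) m
    = (\<Sum>m' \<in> Poly_Mapping.keys p. if m' = m then Poly_Mapping.lookup p m else 0)"
    unfolding weight_poly_eq coeff_sum lookup_sum
    by (intro sum.cong) (auto simp: lookup_single when_def)
  also have "\<dots> = Poly_Mapping.lookup p m"
    using assms(2) by simp
  also have "\<dots> \<noteq> 0"
    using assms(2) by (simp add: in_keys_iff)
  finally show False
    using ne by (simp add: assms(1))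
qed

text \<open>\<open>weight_poly\<close> is a homomorphism into a domain that sends exactly the \<open>w\<close>-homogeneous
  polynomials to monomials, and factors of monomials are monomials.\<close>

lemma weight_factors:
  fixes p q :: "'k::idom mpoly"
  assumes "p * q \<noteq> 0" "\<And>m. m \<in> Poly_Mapping.keys (p * q) \<Longrightarrow> weight w m = d"
  obtains d1 d2 where "d = d1 + d2" "\<forall>m \<in> Poly_Mapping.keys p. weight w m = d1"
    "\<forall>m \<in> Poly_Mapping.keys q. weight w m = d2"
proof -
  interpret W: unital_hom "weight_poly w :: 'k mpoly \<Rightarrow> _"
    unfolding weight_poly_def by (intro unital_hom_mpoly_eval unital_hom_Const_pCons)
  have *: "weight_poly w p * weight_poly w q = monom (p * q) d"
    using weight_poly_eq_monom[of "p * q" w d, OF assms(2)] by (simp add: W.hom_mult)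
  obtain a k where p: "weight_poly w p = monom a k"
    using factor_of_monom[OF *] assms(1) by blast
  obtain b l where q: "weight_poly w q = monom b l"
    using factor_of_monom[of "weight_poly w q" "weight_poly w p"] * assms(1)
    by (metis mult.commute)
  have "monom (a * b) (k + l) = monom (p * q) d"
    using * by (simp add: p q mult_monom)
  then have "d = k + l"
    using assms(1) by (metis degree_monom_eq monom_eq_0_iff)
  then show thesis
    using that weight_eq_if_weight_poly_eq_monom p q by blast
qed

text \<open>Both conditions on a form become homogeneity for some weight: weight 1 everywhere
  measures the degree, and the indicator of one variable measures its exponent. In this shape
  \<open>weight_factors\<close> passes from a product to its factors.\<close>

lemma form_iff_weight:
  "form N d p \<longleftrightarrow> (\<forall>m \<in> Poly_Mapping.keys p. weight (\<lambda>_. 1) m = d \<and>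
     (\<forall>i\<ge>N. weight (\<lambda>j. if j = i then 1 else 0) m = 0))"
proof -
  have "weight (\<lambda>j. if j = i then 1 else 0) m = Poly_Mapping.lookup m i" for i m
    by (auto simp: weight_def if_distrib[of "\<lambda>x. x * _"] in_keys_iff cong: if_cong)
  moreover have "Poly_Mapping.keys m \<subseteq> {..<N} \<longleftrightarrow> (\<forall>i\<ge>N. Poly_Mapping.lookup m i = 0)"
    for m :: "nat \<Rightarrow>\<^sub>0 nat"
    by (metis in_keys_iff lessThan_iff not_le subset_iff)
  moreover have "weight (\<lambda>_. 1) m = (\<Sum>i \<in> Poly_Mapping.keys m. Poly_Mapping.lookup m i)" for m
    by (simp add: weight_def)
  ultimately show ?thesis
    unfolding form_def by (simp add: conj_commute)
qed

lemma form_factors: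
  fixes p q :: "'k::idom mpoly"
  assumes "form N d (p * q)" "p * q \<noteq> 0"
  obtains d1 d2 where "d = d1 + d2" "form N d1 p" "form N d2 q"
proof -
  have 1: "\<And>m. m \<in> Poly_Mapping.keys (p * q) \<Longrightarrow> weight (\<lambda>_. 1) m = d"
    using assms(1) by (simp add: form_iff_weight)
  obtain d1 d2 where d: "d = d1 + d2" "\<forall>m \<in> Poly_Mapping.keys p. weight (\<lambda>_. 1) m = d1"
    "\<forall>m \<in> Poly_Mapping.keys q. weight (\<lambda>_. 1) m = d2"
    by (rule weight_factors[OF assms(2) 1])
  have v: "(\<forall>m \<in> Poly_Mapping.keys p. weight (\<lambda>j. if j = i then 1 else 0) m = 0) \<and>
      (\<forall>m \<in> Poly_Mapping.keys q. weight (\<lambda>j. if j = i then 1 else 0) m = 0)" if "i \<ge> N" for i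
  proof -
    have "\<And>m. m \<in> Poly_Mapping.keys (p * q) \<Longrightarrow> weight (\<lambda>j. if j = i then 1 else 0) m = 0"
      using assms(1) that by (simp add: form_iff_weight)
    from weight_factors[OF assms(2) this] show ?thesis
      by (metis (no_types, lifting) add_is_0)
  qed
  show thesis
    by (rule that[OF d(1)]) (use d v in \<open>auto simp: form_iff_weight\<close>)
qed

text \<open>For q \<noteq> 0 degrees add by \<open>form_factors\<close>, so the truncated
  \<open>d - de\<close> is a genuine difference; for q = 0 any degree will do.\<close>

lemma form_cancel:
  fixes e q :: "'k::idom mpoly"
  assumes "form N d (e * q)" "form N de e" "e \<noteq> 0"
  shows "form N (d - de) q"
proof (cases "q = 0")
  case False
  then have "e * q \<noteq> 0"
    using assms(3) by simp
  then obtain d1 d2 where d: "d = d1 + d2" "form N d1 e" "form N d2 q"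
    by (rule form_factors[OF assms(1)])
  moreover have "d1 = de"
    using form_degree_unique d(2) assms(2,3) by blast
  ultimately show ?thesis by simp
qed simp

lemma form_0_dvd_1:
  fixes c :: "'k::field mpoly"
  assumes "form N 0 c" "c \<noteq> 0"
  shows "c dvd 1"
proof -
  have "m = 0" if "m \<in> Poly_Mapping.keys c" for m
  proof -
    have "\<forall>i \<in> Poly_Mapping.keys m. Poly_Mapping.lookup m i = 0"
      using assms(1) that by (auto simp: form_def)
    then have "Poly_Mapping.keys m = {}"
      by (meson all_not_in_conv lookup_not_eq_zero_eq_in_keys)
    then show "m = 0" by simp
  qed
  then have keys: "Poly_Mapping.keys c = {0}"
    using assms(2) by (metis empty_iff insertI1 keys_eq_empty subsetI subset_singletonD singletonI subset_antisym)
  then have "c = Poly_Mapping.single 0 (Poly_Mapping.lookup c 0)"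
    using sum_single_keys[of c] by simp
  moreover have "Poly_Mapping.lookup c 0 \<noteq> 0"
    using keys by (metis insertI1 lookup_not_eq_zero_eq_in_keys)
  ultimately have "c * Poly_Mapping.single 0 (inverse (Poly_Mapping.lookup c 0)) = 1"
    by (metis add.right_neutral mult_single right_inverse single_one)
  then show ?thesis by (metis dvd_triv_left)
qed

text \<open>Dividing by a common factor of maximal degree avoids unique factorization.\<close>

lemma primitive_part:
  fixes ps :: "'k::field mpoly list"
  assumes "\<And>p. p \<in> set ps \<Longrightarrow> \<exists>d. form N d p" "\<exists>p\<in>set ps. p \<noteq> 0"
  obtains e qs de where "e \<noteq> 0" "ps = map (\<lambda>q. e * q) qs" "no_proper_common_factor (set qs)"
    "form N de e"
proof -
  obtain p0 d0 where p0: "p0 \<in> set ps" "p0 \<noteq> 0" "form N d0 p0"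
    using assms by blast
  define P where "P k \<longleftrightarrow> (\<exists>e. form N k e \<and> (\<forall>p\<in>set ps. e dvd p))" for k
  have bound: "k \<le> d0" if k: "P k" for k
  proof -
    obtain e where e: "form N k e" "\<forall>p\<in>set ps. e dvd p"
      using k by (auto simp: P_def)
    then obtain r where r: "p0 = e * r"
      using p0(1) by (meson dvdE)
    with p0 obtain d1 d2 where "d0 = d1 + d2" "form N d1 e"
      using form_factors by metis
    moreover have "e \<noteq> 0" using r p0 by auto
    ultimately show ?thesis
      using form_degree_unique e(1) by fastforce
  qed
  have "P 0"
    unfolding P_def using form_one by (metis one_dvd)
  then have "P (GREATEST k. P k)"
    using bound by (rule GreatestI_nat)
  define de where "de = (GREATEST k. P k)"
  have max: "k \<le> de" if "P k" for k
    unfolding de_def using that bound by (rule Greatest_le_nat)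
  obtain e where e: "form N de e" "\<forall>p\<in>set ps. e dvd p"
    using \<open>P (GREATEST k. P k)\<close> by (auto simp: P_def de_def)
  then have "\<forall>p\<in>set ps. \<exists>q. p = e * q"
    by (auto elim: dvdE)
  then obtain h where h: "\<forall>p\<in>set ps. p = e * h p"
    by metis
  define qs where "qs = map h ps"
  have "e \<noteq> 0"
    using h p0 by auto
  have ps: "ps = map (\<lambda>q. e * q) qs"
    using h by (auto simp: qs_def intro!: nth_equalityI)
  have "c dvd 1" if c: "\<forall>q\<in>set qs. c dvd q" for c
  proof -
    \<comment> \<open>The product of \<open>e\<close> and \<open>c\<close> is again a common factor,
      so maximality of \<open>de\<close> leaves only degree 0 for \<open>c\<close>.\<close>
    have ec: "\<forall>p\<in>set ps. e * c dvd p"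
      using c by (auto simp: ps intro!: mult_dvd_mono)
    then obtain r where r: "p0 = e * c * r"
      using p0(1) by (meson dvdE)
    then obtain d1 where d1: "form N d1 (e * c)"
      using form_factors p0 by metis
    then have "d1 \<le> de"
      using ec max by (auto simp: P_def)
    have "e * c \<noteq> 0"
      using r p0 by auto
    with d1 obtain d2 d3 where d23: "d1 = d2 + d3" "form N d2 e" "form N d3 c"
      using form_factors by metis
    have "d2 = de"
      using form_degree_unique d23(2) e(1) \<open>e \<noteq> 0\<close> by blast
    then have "form N 0 c"
      using d23 \<open>d1 \<le> de\<close> by simp
    then show "c dvd 1"
      using form_0_dvd_1 \<open>e * c \<noteq> 0\<close> by auto
  qed
  then have prim: "no_proper_common_factor (set qs)"
    by (simp add: no_proper_common_factor_def)
  show thesis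
    using that \<open>e \<noteq> 0\<close> ps prim e(1) by blast
qed

subsection \<open>Polynomials in the last variable\<close>

text \<open>The variable with index \<open>n\<close>, that is x_(n+1), becomes the variable of a
  univariate polynomial. The coefficient type is still the full polynomial ring; that x_(n+1) is
  absent from \<open>q\<close> is expressed by the value being the constant
  \<open>[:q:]\<close>.\<close>

definition last_var_poly :: "nat \<Rightarrow> 'k::comm_ring_1 mpoly \<Rightarrow> 'k mpoly poly" where
  "last_var_poly n = mpoly_eval (\<lambda>a. [:Const a:]) (\<lambda>i. if i = n then [:0, 1:] else [:Var i:])"

lemma unital_hom_last_var_poly: "unital_hom (last_var_poly n)"
  unfolding last_var_poly_def by (intro unital_hom_mpoly_eval unital_hom_Const_pCons)

lemma last_var_poly_Var: "last_var_poly n (Var n) = [:0, 1:]"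
  unfolding last_var_poly_def by (simp add: mpoly_eval_Var[OF unital_hom_Const_pCons])

lemma last_var_poly_const:
  assumes "form n d q"
  shows "last_var_poly n q = [:q:]"
proof -
  have "last_var_poly n q = mpoly_eval (\<lambda>a. [:Const a:]) (\<lambda>i. [:Var i:]) q"
    unfolding last_var_poly_def by (rule mpoly_eval_cong_form[OF assms]) simp
  also have "\<dots> = [:mpoly_eval Const Var q:]"
    by (rule hom_mpoly_eval[OF unital_hom_pCons, symmetric])
  finally show ?thesis by (simp add: mpoly_eval_Const_Var)
qed

lemma poly_last_var_poly: "poly (last_var_poly n p) (Var n) = p"
proof -
  have "unital_hom (\<lambda>P. poly P (Var n :: 'a mpoly))"
    by unfold_locales auto
  then have "poly (last_var_poly n p) (Var n) = mpoly_eval (\<lambda>a. poly [:Const a:] (Var n))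
      (\<lambda>i. poly (if i = n then [:0, 1:] else [:Var i:]) (Var n)) p"
    unfolding last_var_poly_def by (rule hom_mpoly_eval)
  also have "(\<lambda>i. poly (if i = n then [:0, 1:] else [:Var i:]) (Var n)) = (Var :: nat \<Rightarrow> 'a mpoly)"
    by auto
  finally show ?thesis
    by (simp add: mpoly_eval_Const_Var)
qed

text \<open>Homogeneity of total degree \<open>d\<close> when the univariate variable counts as 1.
  It is closed under sums and products, so \<open>form_poly_last_var_poly\<close> needs to check it
  on constants and variables only.\<close>

definition form_poly :: "nat \<Rightarrow> nat \<Rightarrow> 'k::comm_ring_1 mpoly poly \<Rightarrow> bool" where
  "form_poly n d P \<longleftrightarrow> (\<forall>r. if r \<le> d then form n (d - r) (coeff P r) else coeff P r = 0)"

lemma form_poly_mult: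
  assumes "form_poly n d P" "form_poly n e Q"
  shows "form_poly n (d + e) (P * Q)"
  unfolding form_poly_def
proof
  fix r
  show "if r \<le> d + e then form n (d + e - r) (coeff (P * Q) r) else coeff (P * Q) r = 0"
  proof (cases "r \<le> d + e")
    case True
    have "form n (d + e - r) (coeff P i * coeff Q (r - i))" if "i \<le> r" for i
    proof (cases "i \<le> d \<and> r - i \<le> e")
      case True
      then have "form n ((d - i) + (e - (r - i))) (coeff P i * coeff Q (r - i))"
        using assms by (intro form_mult) (auto simp: form_poly_def)
      moreover have "(d - i) + (e - (r - i)) = d + e - r"
        using True that by linarith
      ultimately show ?thesis by simp
    next
      case False
      then have "coeff P i * coeff Q (r - i) = 0"
        using assms by (auto simp: form_poly_def)
      then show ?thesis by simp
    qed
    then show ?thesis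
      using True by (auto simp: coeff_mult intro: form_sum)
  next
    case False
    have "coeff P i * coeff Q (r - i) = 0" for i
      using assms False by (cases "i \<le> d") (auto simp: form_poly_def)
    then show ?thesis
      using False by (auto simp: coeff_mult)
  qed
qed

lemma form_poly_one: "form_poly n 0 1"
  by (auto simp: form_poly_def form_one)

lemma form_poly_power: "form_poly n d P \<Longrightarrow> form_poly n (k * d) (P ^ k)"
  by (induction k) (auto intro: form_poly_one form_poly_mult)

lemma form_poly_prod:
  "(\<And>x. x \<in> S \<Longrightarrow> form_poly n (d x) (g x)) \<Longrightarrow> form_poly n (sum d S) (prod g S)"
  by (induction S rule: infinite_finite_induct) (auto intro: form_poly_one form_poly_mult)

lemma form_poly_sum:
  "(\<And>x. x \<in> S \<Longrightarrow> form_poly n d (g x)) \<Longrightarrow> form_poly n d (sum g S)"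
  by (auto simp: form_poly_def coeff_sum intro!: form_sum sum.neutral)

lemma form_poly_last_var_poly:
  assumes "form (Suc n) d p"
  shows "form_poly n d (last_var_poly n p)"
  unfolding last_var_poly_def mpoly_eval_def
proof (rule form_poly_sum)
  fix m assume m: "m \<in> Poly_Mapping.keys p"
  let ?\<phi> = "\<lambda>i. if i = n then [:0, 1:] else [:Var i:] :: 'a mpoly poly"
  have \<phi>: "form_poly n 1 (?\<phi> i)" if "i < Suc n" for i
    using that form_Var[of i n]
    by (auto simp: form_poly_def coeff_pCons form_one split: nat.split)
  have "form_poly n (\<Sum>i \<in> Poly_Mapping.keys m. Poly_Mapping.lookup m i * 1)
      (\<Prod>i \<in> Poly_Mapping.keys m. ?\<phi> i ^ Poly_Mapping.lookup m i)"
    by (intro form_poly_prod form_poly_power \<phi>) (use m assms in \<open>auto simp: form_def\<close>)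
  moreover have "(\<Sum>i \<in> Poly_Mapping.keys m. Poly_Mapping.lookup m i * 1) = d"
    using m assms by (auto simp: form_def)
  moreover have "form_poly n 0 [:Const (Poly_Mapping.lookup p m):]"
    by (auto simp: form_poly_def coeff_pCons form_Const split: nat.split)
  ultimately show "form_poly n d ([:Const (Poly_Mapping.lookup p m):] *
      (\<Prod>i \<in> Poly_Mapping.keys m. ?\<phi> i ^ Poly_Mapping.lookup m i))"
    using form_poly_mult[of n 0] by fastforce
qed

lemma form_expansion_last_var:
  assumes "form (Suc n) d p"
  shows "p = (\<Sum>r\<le>d. coeff (last_var_poly n p) r * Var n ^ r)"
proof -
  have deg: "degree (last_var_poly n p) \<le> d"
    using form_poly_last_var_poly[OF assms] by (intro degree_le) (auto simp: form_poly_def)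
  have "poly (last_var_poly n p) (Var n) = (\<Sum>r\<le>d. coeff (last_var_poly n p) r * Var n ^ r)"
    unfolding poly_altdef
    by (rule sum.mono_neutral_left) (use deg in \<open>auto simp: coeff_eq_0\<close>)
  then show ?thesis
    by (simp add: poly_last_var_poly)
qed

subsection \<open>Composition and inverses of rational maps\<close>

lemma form_tuple_form: "form_tuple n m fs \<Longrightarrow> \<exists>d. \<forall>i\<le>m. form (n + 1) d (fs ! i)"
  by (metis form_tuple_def less_Suc_eq_le nth_mem Suc_eq_plus1)

lemma form_tuple_nonzero: "form_tuple n m fs \<Longrightarrow> \<exists>i\<le>m. fs ! i \<noteq> 0"
  by (metis form_tuple_def in_set_conv_nth less_Suc_eq_le Suc_eq_plus1)

lemma form_tupleI:
  assumes "length fs = m + 1" "\<And>i. i \<le> m \<Longrightarrow> form (n + 1) d (fs ! i)" "i \<le> m" "fs ! i \<noteq> 0"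
  shows "form_tuple n m fs"
  unfolding form_tuple_def
proof (intro conjI)
  show "\<exists>d. \<forall>f\<in>set fs. form (n + 1) d f"
    using assms(1,2) by (metis in_set_conv_nth less_Suc_eq_le Suc_eq_plus1)
  show "\<exists>f\<in>set fs. f \<noteq> 0"
    using assms by (metis nth_mem less_Suc_eq_le Suc_eq_plus1)
qed fact

lemma Var_nonzero: "Var i \<noteq> (0 :: 'k::comm_ring_1 mpoly)"
  by (metis Var_def keys_single keys_zero insert_not_empty zero_neq_one)

lemma form_tuple_Vars: "m \<le> n \<Longrightarrow> form_tuple n m (map Var [0..<m + 1])"
  by (rule form_tupleI[where i = 0 and d = 1])
    (auto simp del: upt_Suc simp: Var_nonzero form_Var[unfolded One_nat_def])

lemma proportional_nonzero:
  assumes "(fs, gs) \<in> proportional n m" "i \<le> m"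
  shows "fs ! i \<noteq> 0 \<longleftrightarrow> gs ! i \<noteq> 0"
proof -
  have ft: "form_tuple n m fs" "form_tuple n m gs"
    using assms(1) by (auto simp: proportional_def)
  obtain j where j: "j \<le> m" "fs ! j \<noteq> 0"
    using form_tuple_nonzero[OF ft(1)] by blast
  obtain k where k: "k \<le> m" "gs ! k \<noteq> 0"
    using form_tuple_nonzero[OF ft(2)] by blast
  have "fs ! i * gs ! j = fs ! j * gs ! i" "fs ! i * gs ! k = fs ! k * gs ! i"
    using assms j(1) k(1) by (auto simp: proportional_def)
  then show ?thesis
    using j(2) k(2) by auto
qed

lemma mem_ratmap: "gs \<in> ratmap n m fs \<longleftrightarrow> (fs, gs) \<in> proportional n m"
  by (simp add: ratmap_def)

lemma ratmap_eq: "(fs, gs) \<in> proportional n m \<Longrightarrow> ratmap n m fs = ratmap n m gs"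
  unfolding ratmap_def by (rule equiv_class_eq[OF equiv_proportional])

lemma proportional_refl: "form_tuple n m fs \<Longrightarrow> (fs, fs) \<in> proportional n m"
  by (simp add: proportional_def mult.commute)

lemma proportional_sym: "(fs, gs) \<in> proportional n m \<Longrightarrow> (gs, fs) \<in> proportional n m"
  by (auto simp: proportional_def mult.commute)

lemma ratmap_in_ratmaps: "form_tuple n m fs \<Longrightarrow> ratmap n m fs \<in> ratmaps n m"
  unfolding ratmap_def ratmaps_def by (rule quotientI) simp

lemma ratmapsE:
  assumes "F \<in> ratmaps n m"
  obtains fs where "form_tuple n m fs" "F = ratmap n m fs"
  using assms unfolding ratmap_def ratmaps_def by (auto elim: quotientE)

lemma proportionalI:
  assumes "form_tuple n m fs" "form_tuple n m gs" "u \<noteq> 0"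
    and "\<And>i. i \<le> m \<Longrightarrow> u * fs ! i = v * gs ! i"
  shows "(fs, gs) \<in> proportional n m"
proof -
  have "fs ! i * gs ! j = fs ! j * gs ! i" if "i \<le> m" "j \<le> m" for i j
  proof -
    have "u * (fs ! i * gs ! j) = (v * gs ! i) * gs ! j"
      using assms(4)[OF that(1)] by (simp add: mult_ac)
    also have "\<dots> = u * (fs ! j * gs ! i)"
      using assms(4)[OF that(2)] by (simp add: mult_ac)
    finally show ?thesis using assms(3) by simp
  qed
  then show ?thesis
    using assms(1,2) by (simp add: proportional_def)
qed

lemma mpoly_subst_proportional_tuple:
  assumes "(gs, gs') \<in> proportional n m" "form (m + 1) d p" "i \<le> m"
  shows "gs ! i ^ d * mpoly_subst gs' p = gs' ! i ^ d * mpoly_subst gs p"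
proof (rule mpoly_subst_proportional[OF assms(2)])
  show "m + 1 \<le> length gs" "m + 1 \<le> length gs'"
    using assms(1) by (auto simp: proportional_def form_tuple_def)
  show "gs ! i * gs' ! j = gs' ! i * gs ! j" if "j < m + 1" for j
    using assms(1,3) that by (auto simp: proportional_def mult.commute)
qed

lemma mpoly_subst_zero: "mpoly_subst gs 0 = 0"
  by (simp add: mpoly_subst_def)

lemma mpoly_subst_eq_0_proportional:
  assumes "(gs, gs') \<in> proportional n m" "form (m + 1) d p"
  shows "mpoly_subst gs p = 0 \<longleftrightarrow> mpoly_subst gs' p = 0"
proof -
  have "form_tuple n m gs"
    using assms(1) by (simp add: proportional_def)
  then obtain i where i: "i \<le> m" "gs ! i \<noteq> 0"
    using form_tuple_nonzero by blast
  have "gs' ! i \<noteq> 0"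
    using proportional_nonzero[OF assms(1)] i by blast
  then show ?thesis
    using mpoly_subst_proportional_tuple[OF assms i(1)] i(2) by auto
qed

lemma form_tuple_comp:
  assumes "form_tuple m l fs" "form_tuple n m gs" "i \<le> l" "mpoly_subst gs (fs ! i) \<noteq> 0"
  shows "form_tuple n l (map (mpoly_subst gs) fs)"
proof -
  obtain d e where d: "\<forall>i\<le>l. form (m + 1) d (fs ! i)" and e: "\<forall>i\<le>m. form (n + 1) e (gs ! i)"
    using assms form_tuple_form by meson
  have len: "length fs = l + 1"
    using assms(1) by (simp add: form_tuple_def)
  show ?thesis
    by (rule form_tupleI[where i = i and d = "d * e"])
      (use len d e assms(3,4) in \<open>auto intro!: form_mpoly_subst[of "m + 1"]\<close>)
qed

text \<open>Representatives are exchanged one at a time. Passing from \<open>gs\<close> to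
  \<open>gs'\<close> multiplies all values by one common \<open>d\<close>-th power; the cross
  products of \<open>fs\<close> and \<open>fs'\<close> agree as polynomials and therefore still
  agree after substituting \<open>gs'\<close>.\<close>

lemma comp_proportional:
  assumes "(fs, fs') \<in> proportional m l" "(gs, gs') \<in> proportional n m"
    and "form_tuple n l (map (mpoly_subst gs) fs)" "form_tuple n l (map (mpoly_subst gs') fs')"
  shows "(map (mpoly_subst gs) fs, map (mpoly_subst gs') fs') \<in> proportional n l"
proof -
  interpret G: unital_hom "mpoly_subst gs'" by (rule unital_hom_mpoly_subst)
  have fs: "form_tuple m l fs" "form_tuple m l fs'" "form_tuple n m gs"
    using assms by (auto simp: proportional_def)
  obtain d where d: "\<forall>i\<le>l. form (m + 1) d (fs ! i)"
    using fs form_tuple_form by meson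
  obtain a where a: "a \<le> m" "gs ! a \<noteq> 0"
    using fs form_tuple_nonzero by blast
  then have a': "gs' ! a \<noteq> 0"
    using proportional_nonzero[OF assms(2)] by blast
  have len: "length fs = l + 1" "length fs' = l + 1"
    using fs by (auto simp: form_tuple_def)
  have "mpoly_subst gs (fs ! i) * mpoly_subst gs' (fs' ! j)
      = mpoly_subst gs (fs ! j) * mpoly_subst gs' (fs' ! i)" if ij: "i \<le> l" "j \<le> l" for i j
  proof -
    have "gs' ! a ^ d * (mpoly_subst gs (fs ! i) * mpoly_subst gs' (fs' ! j))
        = gs ! a ^ d * (mpoly_subst gs' (fs ! i) * mpoly_subst gs' (fs' ! j))"
      using mpoly_subst_proportional_tuple[OF assms(2) _ a(1), of d "fs ! i"] d ij
      by (simp add: mult.assoc flip: mult.assoc)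
    also have "\<dots> = gs ! a ^ d * mpoly_subst gs' (fs ! i * fs' ! j)"
      by (simp add: G.hom_mult)
    also have "fs ! i * fs' ! j = fs ! j * fs' ! i"
      using assms(1) ij by (simp add: proportional_def)
    also have "gs ! a ^ d * mpoly_subst gs' (fs ! j * fs' ! i)
        = gs ! a ^ d * mpoly_subst gs' (fs ! j) * mpoly_subst gs' (fs' ! i)"
      by (simp add: G.hom_mult mult.assoc)
    also have "\<dots> = gs' ! a ^ d * (mpoly_subst gs (fs ! j) * mpoly_subst gs' (fs' ! i))"
      using mpoly_subst_proportional_tuple[OF assms(2) _ a(1), of d "fs ! j"] d ij
      by (simp add: mult.assoc flip: mult.assoc)
    finally show ?thesis using a' by simp
  qed
  then show ?thesis
    using assms(3,4) len by (simp add: proportional_def)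
qed

text \<open>Representatives with vanishing composite contribute the empty set, and all others lie in
  one class by \<open>comp_proportional\<close>. The third assumption ensures that the given pair is
  of the second kind.\<close>

lemma rat_comp_ratmap:
  assumes "form_tuple m l fs" "form_tuple n m gs" "form_tuple n l (map (mpoly_subst gs) fs)"
  shows "rat_comp n l (ratmap m l fs) (ratmap n m gs) = ratmap n l (map (mpoly_subst gs) fs)"
proof (rule subset_antisym)
  show "ratmap n l (map (mpoly_subst gs) fs) \<subseteq> rat_comp n l (ratmap m l fs) (ratmap n m gs)"
    unfolding rat_comp_def using assms(1,2)[THEN proportional_refl] by (force simp: mem_ratmap)
  show "rat_comp n l (ratmap m l fs) (ratmap n m gs) \<subseteq> ratmap n l (map (mpoly_subst gs) fs)"
  proof
    fix hs assume "hs \<in> rat_comp n l (ratmap m l fs) (ratmap n m gs)"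
    then obtain fs' gs' where 1: "(fs, fs') \<in> proportional m l" "(gs, gs') \<in> proportional n m"
      "(map (mpoly_subst gs') fs', hs) \<in> proportional n l"
      by (auto simp: rat_comp_def mem_ratmap)
    then have "(map (mpoly_subst gs) fs, map (mpoly_subst gs') fs') \<in> proportional n l"
      by (intro comp_proportional assms) (auto simp: proportional_def)
    then have "ratmap n l (map (mpoly_subst gs) fs) = ratmap n l (map (mpoly_subst gs') fs')"
      by (rule ratmap_eq)
    then show "hs \<in> ratmap n l (map (mpoly_subst gs) fs)"
      using 1(3) by (simp add: mem_ratmap)
  qed
qed

lemma Vars_rel:
  assumes "(hs, map Var [0..<n + 1]) \<in> proportional n n" "i \<le> n"
  shows "Var 0 * hs ! i = hs ! 0 * Var i"
proof -
  have "hs ! i * map Var [0..<n + 1] ! 0 = hs ! 0 * map Var [0..<n + 1] ! i"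
    using assms unfolding proportional_def by blast
  then show ?thesis
    using assms(2) by (simp del: upt_Suc add: mult.commute)
qed

text \<open>Here \<open>hs\<close> is the coordinate tuple times \<open>hs ! 0\<close> / x_1, so
  substituting it reproduces \<open>p\<close> up to the \<open>d\<close>-th power of this
  factor.\<close>

lemma mpoly_subst_Vars_rel:
  assumes "(hs, map Var [0..<n + 1]) \<in> proportional n n" "form (n + 1) d p"
  shows "Var 0 ^ d * mpoly_subst hs p = hs ! 0 ^ d * p"
  using mpoly_subst_proportional_tuple[OF proportional_sym[OF assms(1)] assms(2), of 0]
    mpoly_subst_Var[OF assms(2)] by (simp del: upt_Suc)

lemma Vars_nonzero:
  assumes "(hs, map Var [0..<n + 1]) \<in> proportional n n" "i \<le> n"
  shows "hs ! i \<noteq> 0"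
  using proportional_nonzero[OF assms] assms(2) by (simp del: upt_Suc add: Var_nonzero)

lemma mpoly_subst_comp:
  assumes "form_tuple n n a" "form (n + 1) d p"
  shows "mpoly_subst b (mpoly_subst a p) = mpoly_subst (map (mpoly_subst b) a) p"
  by (rule mpoly_subst_mpoly_subst[OF assms(2)]) (use assms(1) in \<open>simp add: form_tuple_def\<close>)

text \<open>A map with a right inverse is dominant.\<close>

lemma mpoly_subst_nonzero_if_right_inverse:
  assumes "(map (mpoly_subst b) a, map Var [0..<n + 1]) \<in> proportional n n"
    and "form_tuple n n a" "form (n + 1) d p" "p \<noteq> 0"
  shows "mpoly_subst a p \<noteq> 0"
proof
  assume "mpoly_subst a p = 0"
  then have "mpoly_subst (map (mpoly_subst b) a) p = 0"
    using mpoly_subst_comp[OF assms(2,3), of b] by (simp add: mpoly_subst_zero)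
  then have "(map (mpoly_subst b) a) ! 0 ^ d * p = 0"
    using mpoly_subst_Vars_rel[OF assms(1,3)] by simp
  then show False
    using Vars_nonzero[OF assms(1), of 0] assms(4) by simp
qed

lemma rat_comp_eq_rat_id:
  assumes "rat_comp n n (ratmap n n a) (ratmap n n b) = rat_id n"
  obtains a' b' where "(a, a') \<in> proportional n n" "(b, b') \<in> proportional n n"
    "(map (mpoly_subst b') a', map Var [0..<n + 1]) \<in> proportional n n"
proof -
  have "map Var [0..<n + 1] \<in> rat_comp n n (ratmap n n a) (ratmap n n b)"
    unfolding assms rat_id_def mem_ratmap by (intro proportional_refl form_tuple_Vars) simp
  then show thesis
    using that unfolding rat_comp_def by (auto simp: mem_ratmap simp del: upt_Suc)
qed

text \<open>The point is that the composites of the given representatives do not vanish. Each of the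
  two equations serves the other: if \<open>b\<close> after \<open>a\<close> is the identity, then
  \<open>b\<close> is dominant, so no nonzero entry of \<open>a\<close> vanishes when evaluated at
  \<open>b\<close>.\<close>

lemma is_rat_inverse_ratmap:
  assumes a: "form_tuple n n a" and b: "form_tuple n n b"
  shows "is_rat_inverse n (ratmap n n a) (ratmap n n b) \<longleftrightarrow>
    (map (mpoly_subst b) a, map Var [0..<n + 1]) \<in> proportional n n \<and>
    (map (mpoly_subst a) b, map Var [0..<n + 1]) \<in> proportional n n" (is "?L \<longleftrightarrow> ?R")
proof
  have comp: "(map (mpoly_subst b) a, map Var [0..<n + 1]) \<in> proportional n n"
    if a: "form_tuple n n a" and b: "form_tuple n n b"
    and 1: "rat_comp n n (ratmap n n a) (ratmap n n b) = rat_id n"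
    and 2: "rat_comp n n (ratmap n n b) (ratmap n n a) = rat_id n"
    for a b :: "'a mpoly list"
  proof -
    obtain b' a' where ba: "(b, b') \<in> proportional n n"
      "(map (mpoly_subst a') b', map Var [0..<n + 1]) \<in> proportional n n"
      by (rule rat_comp_eq_rat_id[OF 2])
    obtain d where d: "\<forall>i\<le>n. form (n + 1) d (a ! i)"
      using a form_tuple_form by blast
    obtain i where i: "i \<le> n" "a ! i \<noteq> 0"
      using a form_tuple_nonzero by blast
    have "form_tuple n n b'"
      using ba(1) by (simp add: proportional_def)
    then have "mpoly_subst b' (a ! i) \<noteq> 0"
      using mpoly_subst_nonzero_if_right_inverse[OF ba(2)] d i by blast
    then have "mpoly_subst b (a ! i) \<noteq> 0"
      using mpoly_subst_eq_0_proportional[OF ba(1)] d i by blast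
    then have ft: "form_tuple n n (map (mpoly_subst b) a)"
      using form_tuple_comp a b i(1) by blast
    then have "ratmap n n (map (mpoly_subst b) a) = ratmap n n (map Var [0..<n + 1])"
      using rat_comp_ratmap[OF a b] 1 by (simp add: rat_id_def)
    moreover have "map Var [0..<n + 1] \<in> ratmap n n (map Var [0..<n + 1] :: 'a mpoly list)"
      unfolding mem_ratmap by (intro proportional_refl form_tuple_Vars) simp
    ultimately show ?thesis
      by (metis mem_ratmap)
  qed
  show "?L \<Longrightarrow> ?R"
    using comp a b unfolding is_rat_inverse_def by blast
  assume R: ?R
  then have ft: "form_tuple n n (map (mpoly_subst b) a)" "form_tuple n n (map (mpoly_subst a) b)"
    by (auto simp: proportional_def)
  have "ratmap n n (map (mpoly_subst b) a) = rat_id n" "ratmap n n (map (mpoly_subst a) b) = rat_id n"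
    using R ratmap_eq unfolding rat_id_def by blast+
  then show ?L
    using rat_comp_ratmap[OF a b ft(1)] rat_comp_ratmap[OF b a ft(2)] ratmap_in_ratmaps[OF b]
    by (simp add: is_rat_inverse_def)
qed

text \<open>As in a monoid, \<open>c\<close> after \<open>a\<close> after \<open>b\<close> is
  computed in two ways: the first two maps cancel and give \<open>b\<close>, the last two cancel and
  give \<open>c\<close>. Dominance of \<open>b\<close> keeps the scaling factors nonzero.\<close>

lemma is_rat_inverse_unique:
  assumes "F \<in> ratmaps n n" "is_rat_inverse n F G" "is_rat_inverse n F G'"
  shows "G = G'"
proof -
  obtain a where a: "form_tuple n n a" "F = ratmap n n a"
    using assms(1) by (rule ratmapsE)
  obtain b where b: "form_tuple n n b" "G = ratmap n n b"
    using assms(2) unfolding is_rat_inverse_def by (blast elim: ratmapsE)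
  obtain c where c: "form_tuple n n c" "G' = ratmap n n c"
    using assms(3) unfolding is_rat_inverse_def by (blast elim: ratmapsE)
  interpret B: unital_hom "mpoly_subst b" by (rule unital_hom_mpoly_subst)
  let ?w = "mpoly_subst b (a ! 0)" and ?v = "mpoly_subst b (mpoly_subst a (c ! 0))"
  have len: "length a = n + 1" "length c = n + 1"
    using a c by (auto simp: form_tuple_def)
  have ab: "(map (mpoly_subst b) a, map Var [0..<n + 1]) \<in> proportional n n"
    and ba: "(map (mpoly_subst a) b, map Var [0..<n + 1]) \<in> proportional n n"
    and ca: "(map (mpoly_subst a) c, map Var [0..<n + 1]) \<in> proportional n n"
    using assms(2,3) is_rat_inverse_ratmap a b c by blast+
  obtain d e where d: "\<forall>i\<le>n. form (n + 1) d (c ! i)" and e: "\<forall>i\<le>n. form (n + 1) e (a ! i)"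
    using a(1) c(1) form_tuple_form by meson
  have nz: "mpoly_subst b p \<noteq> 0" if "form (n + 1) k p" "p \<noteq> 0" for k p
    using mpoly_subst_nonzero_if_right_inverse[OF ba b(1) that] .
  have "mpoly_subst a (c ! 0) \<noteq> 0"
    using Vars_nonzero[OF ca, of 0] len by simp
  moreover have "form (n + 1) (d * e) (mpoly_subst a (c ! 0))"
    by (rule form_mpoly_subst[of "n + 1"]) (use d e in auto)
  ultimately have v: "?v \<noteq> 0"
    using nz by blast
  have "Var 0 ^ d * ?v * b ! i = (b ! 0 * ?w ^ d) * c ! i" if i: "i \<le> n" for i
  proof -
    have "mpoly_subst b (Var 0 * map (mpoly_subst a) c ! i)
        = mpoly_subst b (map (mpoly_subst a) c ! 0 * Var i)"
      by (simp only: Vars_rel[OF ca i])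
    then have 1: "b ! 0 * mpoly_subst b (mpoly_subst a (c ! i)) = ?v * b ! i"
      using i len by (simp add: B.hom_mult mpoly_subst_Var_index)
    have "Var 0 ^ d * mpoly_subst (map (mpoly_subst b) a) (c ! i)
        = map (mpoly_subst b) a ! 0 ^ d * c ! i"
      by (rule mpoly_subst_Vars_rel[OF ab]) (use d i in blast)
    then have 2: "Var 0 ^ d * mpoly_subst b (mpoly_subst a (c ! i)) = ?w ^ d * c ! i"
      using mpoly_subst_comp[OF a(1), of d "c ! i" b] d i len by simp
    have "Var 0 ^ d * ?v * b ! i = Var 0 ^ d * (b ! 0 * mpoly_subst b (mpoly_subst a (c ! i)))"
      by (simp only: 1 mult.assoc)
    also have "\<dots> = b ! 0 * (Var 0 ^ d * mpoly_subst b (mpoly_subst a (c ! i)))"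
      by (rule mult.left_commute)
    finally show ?thesis by (simp add: 2 mult_ac)
  qed
  moreover have "Var 0 ^ d * ?v \<noteq> 0"
    using v by (simp add: Var_nonzero)
  ultimately have "(b, c) \<in> proportional n n"
    using proportionalI[OF b(1) c(1)] by blast
  then show ?thesis
    using b c ratmap_eq by simp
qed

lemma rat_inv_eq:
  assumes "F \<in> ratmaps n n" "is_rat_inverse n F G"
  shows "rat_inv n F = G"
  unfolding rat_inv_def
proof (rule the_equality)
  show "G' = G" if "is_rat_inverse n F G'" for G'
    by (rule is_rat_inverse_unique[OF assms(1) that assms(2)])
qed (rule assms(2))

subsection \<open>Inverses of de Jonquieres transformations\<close>

text \<open>Absence of x_(n+1) is stated through \<open>last_var_poly\<close> so that the degrees of
  the entries need not be tracked.\<close>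

lemma last_var_poly_mpoly_subst:
  assumes "form (length gs) d p" "\<And>q. q \<in> set gs \<Longrightarrow> last_var_poly n q = [:q:]"
  shows "last_var_poly n (mpoly_subst gs p) = [:mpoly_subst gs p:]"
proof -
  have "last_var_poly n (mpoly_eval Const ((!) gs) p)
      = mpoly_eval (\<lambda>a. last_var_poly n (Const a)) (\<lambda>i. last_var_poly n (gs ! i)) p"
    by (rule hom_mpoly_eval[OF unital_hom_last_var_poly])
  also have "\<dots> = mpoly_eval (\<lambda>a. last_var_poly n (Const a)) (\<lambda>i. [:gs ! i:]) p"
    by (rule mpoly_eval_cong_form[OF assms(1)]) (use assms(2) in auto)
  also have "(\<lambda>a. last_var_poly n (Const a :: 'a mpoly)) = (\<lambda>a. [:Const a:])"
    by (rule ext) (rule last_var_poly_const[OF form_Const])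
  also have "mpoly_eval (\<lambda>a. [:Const a:]) (\<lambda>i. [:gs ! i:]) p = [:mpoly_eval Const ((!) gs) p:]"
    by (rule hom_mpoly_eval[OF unital_hom_pCons, symmetric])
  finally show ?thesis by (simp add: mpoly_subst_eq_eval)
qed

text \<open>The two composites have different tasks. \<open>H\<close>, with \<open>ks\<close> after
  J, is expanded in powers of the last coordinate and produces the rows; \<open>R\<close>, with J
  after \<open>ks\<close>, shows that no nonzero form vanishes at \<open>gs\<close>, which carries
  identities at \<open>gs\<close> back to the rows.\<close>

lemma de_jonquieres_inverse:
  fixes gs ks :: "'k::field mpoly list"
  defines "js f g \<equiv> map (\<lambda>h. f * h) gs @ [g]"
  assumes n: "n \<ge> 1" and gs: "form_tuple (n - 1) (n - 1) gs"
    and f: "form (n + 1) df f" and g: "form (n + 1) dg g"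
    and js: "form_tuple n n (js f g)" and ks: "form_tuple n n ks"
    and R: "(map (mpoly_subst ks) (js f g), map Var [0..<n + 1]) \<in> proportional n n"
    and H: "(map (mpoly_subst (js f g)) ks, map Var [0..<n + 1]) \<in> proportional n n"
  obtains p where "form_tuple (n - 1) (n - 1) p"
    "(map (mpoly_subst p) gs, map Var [0..<n - 1 + 1]) \<in> proportional (n - 1) (n - 1)"
    "(map (mpoly_subst gs) p, map Var [0..<n - 1 + 1]) \<in> proportional (n - 1) (n - 1)"
    "\<And>i j. i < n \<Longrightarrow> j < n \<Longrightarrow> ks ! i * p ! j = ks ! j * p ! i"
    "p ! 0 \<noteq> 0" "ks ! 0 \<noteq> 0"
proof -
  define J where "J = js f g"
  interpret G: unital_hom "mpoly_subst gs" by (rule unital_hom_mpoly_subst)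
  interpret K: unital_hom "mpoly_subst ks" by (rule unital_hom_mpoly_subst)
  interpret S: unital_hom "mpoly_subst J" by (rule unital_hom_mpoly_subst)
  interpret L: unital_hom "last_var_poly n :: 'k mpoly \<Rightarrow> _" by (rule unital_hom_last_var_poly)
  let ?L = "last_var_poly n :: 'k mpoly \<Rightarrow> _"
  have len: "length gs = n" "length ks = n + 1" "length J = n + 1"
    using gs ks n by (auto simp: form_tuple_def J_def js_def)
  have Jn: "J ! i = f * gs ! i" if "i < n" for i
    using that len by (simp add: J_def js_def nth_append)
  have Jlast: "J ! n = g"
    using len by (simp add: J_def js_def nth_append)
  obtain m where m: "\<forall>i\<le>n - 1. form (n - 1 + 1) m (gs ! i)"
    using form_tuple_form[OF gs] by blast
  then have m: "form n m (gs ! i)" if "i < n" for i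
    using that n by (metis Suc_eq_plus1 less_Suc_eq_le le_add_diff_inverse2)
  obtain D where D: "form (n + 1) D (ks ! i)" if "i \<le> n" for i
    using form_tuple_form[OF ks] by blast
  define h where "h i = mpoly_subst J (ks ! i)" for i
  have h: "h i \<noteq> 0" "Var 0 * h i = h 0 * Var i" if "i \<le> n" for i
    using Vars_nonzero[OF H that] Vars_rel[OF H that] that len by (auto simp: h_def J_def)
  have hh: "h i * Var j = h j * Var i" if "i \<le> n" "j \<le> n" for i j
    using H that len unfolding proportional_def
    by (auto simp: h_def J_def simp del: upt_Suc)
  define e where "e i = mpoly_subst ks (J ! i)" for i
  have e: "e i \<noteq> 0" "Var 0 * e i = e 0 * Var i" if "i \<le> n" for i
    using Vars_nonzero[OF R that] Vars_rel[OF R that] that len by (auto simp: e_def J_def)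
  have e_eq: "e i = mpoly_subst ks f * mpoly_subst ks (gs ! i)" if "i < n" for i
    using that by (simp add: e_def Jn K.hom_mult)
  have nz: "mpoly_subst ks f \<noteq> 0" "mpoly_subst ks (gs ! 0) \<noteq> 0"
    using e(1)[of 0] e_eq[of 0] n by auto
  then have "f \<noteq> 0"
    by (auto simp: mpoly_subst_zero)
  have "g \<noteq> 0"
    using e(1)[of n] Jlast by (auto simp: e_def mpoly_subst_zero)
  \<comment> \<open>The common factor f(ks) cancels, so \<open>gs\<close> evaluated at
    \<open>ks\<close> is proportional to the first n coordinates.\<close>
  have gk: "Var 0 * mpoly_subst ks (gs ! i) = mpoly_subst ks (gs ! 0) * Var i" if "i < n" for i
    using e(2)[of i] that nz(1) e_eq[OF that] e_eq[of 0] by (simp add: mult_ac)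

  txt \<open>The support is dominant, because \<open>ks\<close> yields a right inverse of it over \<open>k(y_(n+1))\<close>.\<close>
  have indep: "q = 0" if q: "form n d q" and q0: "mpoly_subst gs q = 0" for d q
  proof -
    let ?ks = "map (mpoly_subst ks) gs"
    have "mpoly_subst ?ks q = 0"
      using mpoly_subst_mpoly_subst[OF q, of gs ks] q0 len by (simp add: mpoly_subst_zero)
    moreover have "Var 0 ^ d * mpoly_subst ?ks q
        = mpoly_subst ks (gs ! 0) ^ d * mpoly_subst (map Var [0..<n]) q"
      by (rule mpoly_subst_proportional[OF q]) (use len gk in auto)
    ultimately show "q = 0"
      using nz(2) by (simp add: mpoly_subst_Var[OF q])
  qed

  \<comment> \<open>Coefficients of the inverse in the last variable, and their values\<close>
  define A where "A i r = coeff (?L (ks ! i)) r" for i r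
  have A: "form n (D - r) (A i r)" if "r \<le> D" "i \<le> n" for i r
    using form_poly_last_var_poly[of n D "ks ! i"] D[OF that(2)] that(1)
    by (auto simp: form_poly_def A_def split: if_splits)
  have ks_eq: "ks ! i = (\<Sum>r\<le>D. A i r * Var n ^ r)" if "i \<le> n" for i
    unfolding A_def by (rule form_expansion_last_var) (use D[OF that] in simp)
  define a where "a i r = mpoly_subst gs (A i r)" for i r
  have a_form: "form n ((D - r) * m) (a i r)" if "r \<le> D" "i \<le> n" for i r
    unfolding a_def by (rule form_mpoly_subst[OF A[OF that]]) (rule m)
  \<comment> \<open>\<open>A i r\<close> is a form of degree D - r that does not see the last entry
    of \<open>J\<close>; the other entries share the factor \<open>f\<close>, which comes out to the
    power D - r.\<close>
  have JA: "mpoly_subst J (A i r) = f ^ (D - r) * a i r" if "r \<le> D" "i \<le> n" for i r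
  proof -
    have "mpoly_subst J (A i r) = mpoly_subst (map (\<lambda>h. f * h) gs) (A i r)"
      unfolding mpoly_subst_eq_eval
      by (rule mpoly_eval_cong_form[OF A[OF that]]) (use Jn len in auto)
    also have "\<dots> = f ^ (D - r) * a i r"
      unfolding a_def by (rule mpoly_subst_scale[OF A[OF that]]) (use len in simp)
    finally show ?thesis .
  qed
  have h_eq: "h i = (\<Sum>r\<le>D. a i r * (f ^ (D - r) * g ^ r))" if "i \<le> n" for i
  proof -
    have "h i = (\<Sum>r\<le>D. mpoly_subst J (A i r) * g ^ r)"
      unfolding h_def ks_eq[OF that]
      by (simp add: S.hom_sum S.hom_mult S.hom_power mpoly_subst_Var_index Jlast)
    also have "\<dots> = (\<Sum>r\<le>D. a i r * (f ^ (D - r) * g ^ r))"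
      by (rule sum.cong) (use JA that in \<open>auto simp: mult_ac\<close>)
    finally show ?thesis .
  qed

  define \<alpha> where "\<alpha> = lead_coeff (?L f)"
  define \<beta> where "\<beta> = lead_coeff (?L g)"
  have coeff_const: "?L (coeff (?L q) r) = [:coeff (?L q) r:]" if q: "form (n + 1) d q" for q r d
  proof -
    have "form_poly n d (?L q)"
      using form_poly_last_var_poly q by simp
    then have "\<exists>d'. form n d' (coeff (?L q) r)"
      unfolding form_poly_def by (metis form_zero)
    then show ?thesis
      using last_var_poly_const by blast
  qed
  have Lf: "?L f \<noteq> 0" and Lg: "?L g \<noteq> 0"
    using \<open>f \<noteq> 0\<close> \<open>g \<noteq> 0\<close> by (metis poly_last_var_poly poly_0)+
  txt \<open>If \<open>f/g\<close> did not involve the last variable, then \<open>J\<close> would be given by forms in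
    \<open>x_1, ..., x_n\<close>, and \<open>x_(n+1)\<close> could not be recovered from them.\<close>
  have not_prop: "smult \<alpha> (?L g) \<noteq> smult \<beta> (?L f)"
  proof
    assume "smult \<alpha> (?L g) = smult \<beta> (?L f)"
    then have \<alpha>\<beta>: "\<alpha> * g = \<beta> * f"
      by (metis poly_last_var_poly poly_smult)
    have "\<beta> \<noteq> 0"
      using Lg by (simp add: \<beta>_def)
    \<comment> \<open>Multiplying \<open>J\<close> by \<beta> and using \<alpha> g = \<beta> f lets
      \<open>g\<close> factor out of every entry. The remaining tuple represents the same map and is
      free of x_(n+1).\<close>
    define T where "T = map (\<lambda>h. \<alpha> * h) gs @ [\<beta>]"
    have T: "\<beta> * J ! i = g * T ! i" if "i < n + 1" for i
    proof (cases "i < n")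
      case True
      then have "\<beta> * J ! i = (\<beta> * f) * gs ! i"
        by (simp add: Jn mult_ac)
      also have "\<dots> = g * T ! i"
        using True len by (simp add: T_def nth_append mult_ac flip: \<alpha>\<beta>)
      finally show ?thesis .
    next
      case False
      then have "i = n" using that by simp
      then show ?thesis
        using len Jlast by (simp add: T_def nth_append mult_ac)
    qed
    define q where "q i = mpoly_subst T (ks ! i)" for i
    have q: "\<beta> ^ D * h i = g ^ D * q i" if "i \<le> n" for i
      unfolding h_def q_def
      by (rule mpoly_subst_proportional[OF D[OF that]]) (use T len in \<open>auto simp: T_def\<close>)
    have Lq: "?L (q i) = [:q i:]" if "i \<le> n" for i
      unfolding q_def
    proof (rule last_var_poly_mpoly_subst)
      show "form (length T) D (ks ! i)"
        using D[OF that] len by (simp add: T_def)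
      have gsL: "?L x = [:x:]" if "x \<in> set gs" for x
        using that m len last_var_poly_const by (metis in_set_conv_nth)
      have "?L \<alpha> = [:\<alpha>:]" "?L \<beta> = [:\<beta>:]"
        using coeff_const f g by (auto simp: \<alpha>_def \<beta>_def)
      then show "?L t = [:t:]" if "t \<in> set T" for t
        using that gsL by (auto simp: T_def L.hom_mult)
    qed
    have "g ^ D * (q 0 * Var n) = (\<beta> ^ D * h 0) * Var n"
      using q[of 0] by (simp add: mult_ac)
    also have "\<dots> = (\<beta> ^ D * h n) * Var 0"
      using hh[of 0 n] by (simp add: mult_ac)
    also have "\<dots> = g ^ D * (q n * Var 0)"
      using q[of n] by (simp add: mult_ac)
    finally have "q 0 * Var n = q n * Var 0"
      using \<open>g \<noteq> 0\<close> by simp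
    then have "?L (q 0) * ?L (Var n) = ?L (q n) * ?L (Var 0)"
      by (metis L.hom_mult)
    moreover have "?L (Var 0) = [:Var 0:]"
      by (rule last_var_poly_const[OF form_Var]) (use n in simp)
    \<comment> \<open>As polynomials in x_(n+1), the right side is constant while the left side has
      linear coefficient \<open>q 0\<close>.\<close>
    ultimately have "q 0 = 0"
      by (simp add: Lq last_var_poly_Var)
    then show False
      using q[of 0] h(1)[of 0] \<open>\<beta> \<noteq> 0\<close> by simp
  qed

  have rows: "a i r * Var j = a j r * Var i" if r: "r \<le> D" and ij: "i < n" "j < n" for i j r
  proof -
    \<comment> \<open>The c r are free of x_(n+1), so the cross relation between \<open>h i\<close>
      and \<open>h j\<close> becomes a homogeneous relation in \<open>f\<close> and \<open>g\<close>
      with constant coefficients.\<close>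
    define c where "c r = a i r * Var j - a j r * Var i" for r
    have Lc: "?L (c r) = [:c r:]" if "r \<le> D" for r
    proof (rule last_var_poly_const)
      show "form n ((D - r) * m + 1) (c r)"
        unfolding c_def by (intro form_diff form_mult form_Var a_form) (use that ij in auto)
    qed
    have "(\<Sum>r\<le>D. c r * (f ^ (D - r) * g ^ r)) = h i * Var j - h j * Var i"
      using ij by (simp add: c_def h_eq sum_subtractf sum_distrib_left sum_distrib_right algebra_simps)
    also have "\<dots> = 0"
      using hh ij by simp
    finally have "?L (\<Sum>r\<le>D. c r * (f ^ (D - r) * g ^ r)) = 0"
      by (simp add: L.hom_zero)
    then have "(\<Sum>r\<le>D. smult (c r) (?L f ^ (D - r) * ?L g ^ r)) = 0"
      by (simp add: L.hom_sum L.hom_mult L.hom_power Lc)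
    then have "c r = 0"
      using homogeneous_relation_trivial[OF Lf Lg] not_prop r by (simp add: \<alpha>_def \<beta>_def)
    then show ?thesis by (simp add: c_def)
  qed

  \<comment> \<open>A nonzero row as inverse of the support\<close>
  have "ks ! 0 \<noteq> 0"
    using h(1)[of 0] by (auto simp: h_def mpoly_subst_zero)
  \<comment> \<open>The row is chosen by its first entry, so that \<open>p ! 0\<close> is nonzero
    and can later serve as multiplier of \<open>ks\<close>.\<close>
  then obtain s where s: "s \<le> D" "A 0 s \<noteq> 0"
    using ks_eq[of 0] by (metis (no_types, lifting) atMost_iff le0 mult_zero_left sum.neutral)
  define p where "p = map (\<lambda>i. A i s) [0..<n]"
  have p_nth: "p ! i = A i s" if "i < n" for i
    using that by (simp add: p_def)
  have a0: "a 0 s \<noteq> 0"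
    using indep A[OF s(1), of 0] s(2) by (auto simp: a_def)
  have p_form: "form n (D - s) (p ! i)" if "i < n" for i
    using A s(1) that by (simp add: p_nth)
  have p: "form_tuple (n - 1) (n - 1) p"
    by (rule form_tupleI[where i = 0 and d = "D - s"])
      (use n p_form s(2) in \<open>auto simp: p_nth p_def\<close>)
  have p_gs: "(map (mpoly_subst gs) p, map Var [0..<n - 1 + 1]) \<in> proportional (n - 1) (n - 1)"
  proof (rule proportionalI)
    show "form_tuple (n - 1) (n - 1) (map (mpoly_subst gs) p)"
      by (rule form_tuple_comp[OF p gs, of 0]) (use n a0 in \<open>auto simp: p_nth a_def\<close>)
    show "form_tuple (n - 1) (n - 1) (map Var [0..<n - 1 + 1] :: 'k mpoly list)"
      by (rule form_tuple_Vars) simp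
    show "Var 0 * map (mpoly_subst gs) p ! i = a 0 s * map Var [0..<n - 1 + 1] ! i"
      if "i \<le> n - 1" for i
      using rows[OF s(1), of i 0] that n by (simp add: p_def a_def mult.commute del: upt_Suc)
  qed (rule Var_nonzero)

  \<comment> \<open>Since \<open>p\<close> after \<open>gs\<close> is the identity up to the factor
    \<open>a 0 s\<close> / x_1, applying \<open>gs\<close> once more returns \<open>gs\<close> up to
    the m-th power of this factor.\<close>
  have gsp: "Var 0 ^ m * mpoly_subst gs (mpoly_subst p (gs ! i)) = a 0 s ^ m * gs ! i"
    if "i < n" for i
  proof -
    have "Var 0 ^ m * mpoly_subst (map (mpoly_subst gs) p) (gs ! i)
        = map (mpoly_subst gs) p ! 0 ^ m * gs ! i"
      by (rule mpoly_subst_Vars_rel[OF p_gs]) (use m[OF that] n in simp)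
    then show ?thesis
      using mpoly_subst_mpoly_subst[OF m[OF that], of p gs] n by (simp add: p_def a_def)
  qed
  \<comment> \<open>This composite is not computed directly: its cross relations are forms in n
    variables, hold at \<open>gs\<close> by \<open>gsp\<close>, and therefore hold identically by
    \<open>indep\<close>.\<close>
  have gs_p: "(map (mpoly_subst p) gs, map Var [0..<n - 1 + 1]) \<in> proportional (n - 1) (n - 1)"
  proof -
    have "mpoly_subst p (gs ! i) * Var j = mpoly_subst p (gs ! j) * Var i"
      if ij: "i < n" "j < n" for i j
    proof -
      let ?q = "mpoly_subst p (gs ! i) * Var j - mpoly_subst p (gs ! j) * Var i"
      have "form n (m * (D - s) + 1) ?q"
        by (intro form_diff form_mult form_Var form_mpoly_subst[OF m] p_form) (use ij in auto)
      moreover have "mpoly_subst gs ?q = mpoly_subst gs (mpoly_subst p (gs ! i)) * gs ! j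
          - mpoly_subst gs (mpoly_subst p (gs ! j)) * gs ! i"
        by (simp add: G.hom_diff G.hom_mult mpoly_subst_Var_index)
      moreover have "Var 0 ^ m * (mpoly_subst gs (mpoly_subst p (gs ! i)) * gs ! j
          - mpoly_subst gs (mpoly_subst p (gs ! j)) * gs ! i) = 0"
        using gsp[OF ij(1)] gsp[OF ij(2)] by (simp add: right_diff_distrib flip: mult.assoc)
      ultimately have "?q = 0"
        using indep Var_nonzero by (metis mult_eq_0_iff power_not_zero)
      then show ?thesis by simp
    qed
    moreover obtain i where "i \<le> n - 1" "gs ! i \<noteq> 0"
      using form_tuple_nonzero[OF gs] by blast
    then have "form_tuple (n - 1) (n - 1) (map (mpoly_subst p) gs)"
    proof (intro form_tuple_comp[OF gs p])
      have "i < n" using \<open>i \<le> n - 1\<close> n by linarith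
      then show "mpoly_subst p (gs ! i) \<noteq> 0"
        using gsp[of i] a0 \<open>gs ! i \<noteq> 0\<close> by (auto simp: mpoly_subst_zero)
    qed
    moreover have "form_tuple (n - 1) (n - 1) (map Var [0..<n - 1 + 1] :: 'k mpoly list)"
      by (rule form_tuple_Vars) simp
    ultimately show ?thesis
      using n len unfolding proportional_def by (auto simp del: upt_Suc)
  qed

  have "ks ! i * p ! j = ks ! j * p ! i" if ij: "i < n" "j < n" for i j
  proof -
    \<comment> \<open>At \<open>gs\<close> both rows are proportional to (x_1, ..., x_n), so the
      minor vanishes there; by \<open>indep\<close> it is zero. The factor x_1 is inserted to apply
      \<open>rows\<close> against the first column.\<close>
    have "A i r * A j s = A j r * A i s" if r: "r \<le> D" for r
    proof -
      let ?q = "A i r * A j s - A j r * A i s"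
      have "form n ((D - r) + (D - s)) ?q"
        by (intro form_diff form_mult A) (use r s(1) ij in auto)
      moreover have "mpoly_subst gs ?q = a i r * a j s - a j r * a i s"
        by (simp add: a_def G.hom_diff G.hom_mult)
      moreover have "Var 0 * (a i r * a j s) = Var 0 * (a j r * a i s)"
      proof -
        have "Var 0 * (a i r * a j s) = (a i r * Var 0) * a j s"
          by (simp add: mult_ac)
        also have "\<dots> = a 0 r * (a j s * Var i)"
          using rows[OF r, of i 0] ij by (simp add: mult_ac)
        also have "\<dots> = a i s * (a 0 r * Var j)"
          using rows[OF s(1) ij] by (simp add: mult_ac)
        also have "\<dots> = Var 0 * (a j r * a i s)"
          using rows[OF r, of j 0] ij by (simp add: mult_ac)
        finally show ?thesis .
      qed
      ultimately have "?q = 0"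
        using indep Var_nonzero by (metis mult_left_cancel right_minus_eq)
      then show ?thesis by simp
    qed
    then have "Var n ^ r * (A i r * A j s) = Var n ^ r * (A j r * A i s)" if "r \<le> D" for r
      using that by simp
    then have "(\<Sum>r\<le>D. A i r * Var n ^ r * A j s) = (\<Sum>r\<le>D. A j r * Var n ^ r * A i s)"
      by (intro sum.cong) (simp_all only: atMost_iff mult_ac)
    then show ?thesis
      using ij by (simp add: ks_eq p_nth sum_distrib_right)
  qed
  then show thesis
    using that[OF p gs_p p_gs] s(2) \<open>ks ! 0 \<noteq> 0\<close> n by (simp add: p_nth)
qed

theorem proposition1p8:
  fixes J F :: "'k::field mpoly list set" and n :: nat
  assumes "infinite (UNIV :: 'k set)"
    and "n \<ge> 1"
    and "gen_de_jonquieres n J F"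
  shows "gen_de_jonquieres n (rat_inv n J) (rat_inv (n - 1) F)"
proof -
  obtain gs f g where J: "J \<in> ratmaps n n" and F: "F \<in> ratmaps (n - 1) (n - 1)"
    and gs: "form_tuple (n - 1) (n - 1) gs" "F = ratmap (n - 1) (n - 1) gs"
    and fg: "\<exists>d. form (n + 1) d f" "\<exists>d. form (n + 1) d g"
    and js: "form_tuple n n (map (\<lambda>h. f * h) gs @ [g])" "J = ratmap n n (map (\<lambda>h. f * h) gs @ [g])"
    and "cremona n J"
    using assms(3) unfolding gen_de_jonquieres_def by blast
  then obtain G where G: "is_rat_inverse n J G"
    unfolding cremona_def by blast
  then obtain ks where ks: "form_tuple n n ks" "G = ratmap n n ks"
    unfolding is_rat_inverse_def by (blast elim: ratmapsE)
  obtain p where p: "form_tuple (n - 1) (n - 1) p"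
    "(map (mpoly_subst p) gs, map Var [0..<n - 1 + 1]) \<in> proportional (n - 1) (n - 1)"
    "(map (mpoly_subst gs) p, map Var [0..<n - 1 + 1]) \<in> proportional (n - 1) (n - 1)"
    "\<And>i j. i < n \<Longrightarrow> j < n \<Longrightarrow> ks ! i * p ! j = ks ! j * p ! i"
    "p ! 0 \<noteq> 0" "ks ! 0 \<noteq> 0"
    using de_jonquieres_inverse[OF assms(2) gs(1)] fg js(1) ks(1)
      G[unfolded js(2) ks(2) is_rat_inverse_ratmap[OF js(1) ks(1)]] by metis
  have F_inv: "is_rat_inverse (n - 1) F (ratmap (n - 1) (n - 1) p)"
    unfolding gs(2) is_rat_inverse_ratmap[OF gs(1) p(1)] using p(2,3) by blast

  \<comment> \<open>Cancelling common factors\<close>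
  obtain dp where dp: "form n dp q" if "q \<in> set p" for q
    using p(1) assms(2) by (auto simp: form_tuple_def)
  obtain e qs de where e: "e \<noteq> 0" "p = map (\<lambda>q. e * q) qs" "no_proper_common_factor (set qs)"
    "form n de e"
  proof (rule primitive_part[where ps = p and N = n])
    show "\<exists>q\<in>set p. q \<noteq> 0"
      using p(1) by (simp add: form_tuple_def)
  qed (use dp in blast)+
  have len: "length qs = n" "length ks = n + 1" "length p = n"
    using e(2) p(1) ks(1) assms(2) by (auto simp: form_tuple_def)
  have p_nth: "p ! i = e * qs ! i" if "i < n" for i
    using that len by (simp add: e(2))
  define dq where "dq = dp - de"
  have qs_form: "form n dq (qs ! i)" if "i < n" for i
    unfolding dq_def by (rule form_cancel[OF _ e(4) e(1)])
      (use dp[of "p ! i"] nth_mem[of i p] p_nth[OF that] that len in simp)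
  have qs0: "qs ! 0 \<noteq> 0"
    using p(5) p_nth[of 0] assms(2) by auto
  have qs: "form_tuple (n - 1) (n - 1) qs"
    by (rule form_tupleI[where i = 0 and d = dq]) (use assms(2) len qs_form qs0 in auto)
  have "(p, qs) \<in> proportional (n - 1) (n - 1)"
    by (rule proportionalI[OF p(1) qs, of 1 e]) (use p_nth assms(2) in auto)
  then have F_inv: "is_rat_inverse (n - 1) F (ratmap (n - 1) (n - 1) qs)"
    using F_inv ratmap_eq by metis
  then have rat_inv_F: "rat_inv (n - 1) F = ratmap (n - 1) (n - 1) qs"
    using rat_inv_eq F by blast

  obtain D where D: "form (n + 1) D (ks ! i)" if "i \<le> n" for i
    using form_tuple_form[OF ks(1)] by blast
  have qs_form': "form (n + 1) dq (qs ! i)" if "i \<le> n - 1" for i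
    by (rule form_mono[OF qs_form]) (use that assms(2) in auto)
  then have qs0_form: "form (n + 1) dq (qs ! 0)"
    by simp
  \<comment> \<open>The multiplier is \<open>qs ! 0\<close> rather than \<open>p ! 0\<close>, as the
    factor \<open>e\<close> is already removed. These two polynomials are the candidates for f' and
    g', up to their common factor e'.\<close>
  obtain e' ts de' where e': "e' \<noteq> 0" "[ks ! 0, qs ! 0 * ks ! n] = map (\<lambda>q. e' * q) ts"
    "no_proper_common_factor (set ts)" "form (n + 1) de' e'"
  proof (rule primitive_part[where ps = "[ks ! 0, qs ! 0 * ks ! n]" and N = "n + 1"])
    show "\<exists>d. form (n + 1) d q" if "q \<in> set [ks ! 0, qs ! 0 * ks ! n]" for q
      using that D[of 0] D[of n] qs0_form form_mult by fastforce
  qed (use p(6) in auto)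
  then obtain f' g' where ts: "ts = [f', g']"
    by (auto simp: Cons_eq_map_conv)
  have f': "ks ! 0 = e' * f'" and g': "qs ! 0 * ks ! n = e' * g'"
    using e'(2) by (auto simp: ts)
  have f'_form: "form (n + 1) (D - de') f'"
    using form_cancel[OF _ e'(4) e'(1)] D[of 0] f' by simp
  have g'_form: "form (n + 1) (dq + D - de') g'"
    by (rule form_cancel[OF _ e'(4) e'(1)]) (use form_mult[OF qs0_form D[of n]] g' in simp)
  define T where "T = map (\<lambda>h. f' * h) qs @ [g']"
  have lenT: "length T = n + 1"
    using len by (simp add: T_def)
  have T_nth: "T ! i = f' * qs ! i" if "i < n" for i
    using that len by (simp add: T_def nth_append)
  have T_last: "T ! n = g'"
    using len by (simp add: T_def nth_append)
  \<comment> \<open>\<open>T\<close> is \<open>ks\<close> times the fraction \<open>qs ! 0\<close> /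
    e': for i < n by proportionality of \<open>ks\<close> and \<open>qs\<close>, and for the last
    entry by the choice of g'.\<close>
  have T_ks: "e' * T ! i = qs ! 0 * ks ! i" if "i \<le> n" for i
  proof (cases "i < n")
    case True
    then have "e * (ks ! 0 * qs ! i) = e * (qs ! 0 * ks ! i)"
      using p(4)[of 0 i] p_nth[of i] p_nth[of 0] by (simp add: mult_ac)
    then show ?thesis
      using True e(1) f' by (simp add: T_nth mult_ac)
  next
    case False
    then show ?thesis
      using that g' T_last by simp
  qed
  have "f' \<noteq> 0"
    using f' p(6) by auto
  have T: "form_tuple n n T"
  proof (rule form_tupleI[where i = 0 and d = "dq + D - de'"])
    show "form (n + 1) (dq + D - de') (T ! i)" if "i \<le> n" for i
      by (rule form_cancel[OF _ e'(4) e'(1)])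
        (use form_mult[OF qs0_form D[OF that]] T_ks[OF that] in simp)
    show "T ! 0 \<noteq> 0"
      using T_nth[of 0] assms(2) qs0 \<open>f' \<noteq> 0\<close> by simp
  qed (use lenT in auto)
  have "(T, ks) \<in> proportional n n"
    by (rule proportionalI[OF T ks(1) e'(1)]) (rule T_ks)
  then have G_T: "G = ratmap n n T"
    using ks(2) ratmap_eq by metis
  have rat_inv_J: "rat_inv n J = ratmap n n T"
    using rat_inv_eq[OF J G] G_T by simp

  \<comment> \<open>Confluence and birationality of the inverse\<close>
  let ?x = "map Var [0..<n] :: 'k mpoly list"
  have x: "form_tuple n (n - 1) ?x"
    using form_tuple_Vars[of "n - 1" n] assms(2) by simp
  have qs': "form_tuple n (n - 1) qs"
    by (rule form_tupleI[where i = 0 and d = dq])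
      (use assms(2) len qs0 qs_form' in auto)
  have fqs: "form_tuple n (n - 1) (map (\<lambda>h. f' * h) qs)"
  proof (rule form_tupleI[where i = 0 and d = "(D - de') + dq"])
    show "form (n + 1) ((D - de') + dq) (map (\<lambda>h. f' * h) qs ! i)" if "i \<le> n - 1" for i
    proof -
      have "i < length qs"
        using that len assms(2) by linarith
      then show ?thesis
        using form_mult[OF f'_form qs_form'[OF that]] by simp
    qed
  qed (use assms(2) len qs0 \<open>f' \<noteq> 0\<close> in auto)
  have "map (mpoly_subst ?x) qs = qs"
    by (rule map_idI) (use len qs_form mpoly_subst_Var in \<open>metis in_set_conv_nth\<close>)
  then have comp1: "rat_comp n (n - 1) (ratmap (n - 1) (n - 1) qs) (rat_proj n) = ratmap n (n - 1) qs"
    unfolding rat_proj_def using rat_comp_ratmap[OF qs x] qs' by simp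
  have "map (mpoly_subst T) ?x = map (\<lambda>h. f' * h) qs"
    by (rule nth_equalityI) (use len T_nth in \<open>auto simp: mpoly_subst_Var_index\<close>)
  then have comp2: "rat_comp n (n - 1) (rat_proj n) (ratmap n n T) = ratmap n (n - 1) (map (\<lambda>h. f' * h) qs)"
    unfolding rat_proj_def using rat_comp_ratmap[OF x T] fqs by simp
  have "(map (\<lambda>h. f' * h) qs, qs) \<in> proportional n (n - 1)"
    by (rule proportionalI[OF fqs qs', of 1 f']) (use len assms(2) in auto)
  then have "ratmap n (n - 1) (map (\<lambda>h. f' * h) qs) = ratmap n (n - 1) qs"
    by (rule ratmap_eq)
  then have conf: "confluent n (ratmap n n T) (ratmap (n - 1) (n - 1) qs)"
    unfolding confluent_def comp1 comp2 using ratmap_in_ratmaps[OF qs'] by simp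

  have "is_rat_inverse n (ratmap n n T) J"
    using G J unfolding is_rat_inverse_def G_T by blast
  then have crem: "cremona n (ratmap n n T)"
    unfolding cremona_def using ratmap_in_ratmaps[OF T] by blast
  have "no_proper_common_factor {f', g'}"
    using e'(3) by (simp add: ts)
  then have "\<exists>gs f g. form_tuple (n - 1) (n - 1) gs \<and> no_proper_common_factor (set gs) \<and>
        ratmap (n - 1) (n - 1) qs = ratmap (n - 1) (n - 1) gs \<and>
        (\<exists>d. form (n + 1) d f) \<and> (\<exists>d. form (n + 1) d g) \<and> no_proper_common_factor {f, g} \<and>
        form_tuple n n (map (\<lambda>h. f * h) gs @ [g]) \<and>
        ratmap n n T = ratmap n n (map (\<lambda>h. f * h) gs @ [g])"
    using qs e(3) f'_form g'_form T unfolding T_def by blast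
  then show ?thesis
    unfolding gen_de_jonquieres_def rat_inv_J rat_inv_F
    using conf crem ratmap_in_ratmaps[OF T] ratmap_in_ratmaps[OF qs] by blast
qed

end
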